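(* Any tensor model has an intermediate field representation involving a complex matrix of size $N^D\times N^D$. More precisely, let $B$ be a bubble with $2n$ vertices and let $\Omega$ be any pairing of its vertices. Then, formally (i.e. as formal power series in the coupling constant $\lambda$), the associated partition function satisfies $$Z_B(\lambda,N)=\int e^{-\frac{\lambda}{n}N^{s}\operatorname{Tr}_B(T,\bar T)}\,d\mu(T,\bar T)=\int e^{-\frac{\lambda}{n}N^{s-n(D-1)}V_{B,\Omega}(M)-\operatorname{Tr}\ln(\mathbb{1}^{\otimes D}+\bar M)}\,d\nu(M,\bar M),$$ where $d\nu(M,\bar M)=\frac{dM\,d\bar M}{\pi^{N^{2D}}}e^{-\operatorname{Tr}(M\bar M)}$ and $V_{B,\Omega}$ is the matrix bubble equivalent to $B$ with pairing $\Omega$; and the generating function of the cumulants is $$Z_B[\lambda,N;J,\bar J]=\int e^{-\frac{\lambda}{n}N^{s-n(D-1)}V_{B,\Omega}(M)-\operatorname{Tr}\ln(\mathbb{1}^{\otimes D}+\bar M)-\operatorname{Tr}\left[(J\otimes\bar J)\,(\mathbb{1}^{\otimes D}+\bar M)^{-1}\right]}\,d\nu(M,\bar M).$$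
   Context: A bubble (in dimension $D$) is a connected bipartite (black/white) $D$-regular graph, properly edge-colored with colors $1,\dots,D$. A pairing $\Omega$ is a partition of its vertices into pairs of one white and one black vertex, i.e. a bijection $a\mapsto b(a)$ from white to black vertices. $T=(T_{i_1\cdots i_D})$, $1\le i_c\le N$, is a complex tensor, $\bar T$ its complex conjugate, and $T\cdot\bar T=\sum T_{i_1\cdots i_D}\bar T_{i_1\cdots i_D}$. $d\mu$ is the normalized Gaussian measure with density proportional to $e^{-N^{D-1}T\cdot\bar T}$, and $s$ is a real parameter (the scaling). $\operatorname{Tr}_B(T,\bar T)$ is the polynomial obtained by associating to each white vertex $a$ a factor $T_{i^a_1\cdots i^a_D}$, to each black vertex $b$ a factor $\bar T_{j^b_1\cdots j^b_D}$, imposing $i^a_c=j^b_c$ whenever $a$ and $b$ are joined by an edge of color $c$, and summing over all indices. The generating function with sources $J,\bar J$ (tensors of the same size as $T,\bar T$) is the partition function with the source terms added in the exponent: $Z_B[\lambda,N;J,\bar J]=\int e^{-\frac{\lambda}{n}N^{s}\operatorname{Tr}_B(T,\bar T)-\bar J\cdot T-\bar T\cdot J}\,d\mu(T,\bar T)$. $M=(M_{I;K})$ is an $N^D\times N^D$ complex matrix indexed by multi-indices $I=(i_1,\dots,i_D)$, $K=(j_1,\dots,j_D)$; $\bar M$ is its conjugate, and $\operatorname{Tr}(M\bar M)$ in the Gaussian weight stands for $\sum_{I,K}M_{I;K}\bar M_{I;K}$. The matrix bubble $V_{B,\Omega}(M)$ is obtained from $\operatorname{Tr}_B$ by replacing,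 for each white vertex $a$, the product $T_{i^a_1\cdots i^a_D}\bar T_{j^{b(a)}_1\cdots j^{b(a)}_D}$ by $M_{(i^a_1\cdots i^a_D);(j^{b(a)}_1\cdots j^{b(a)}_D)}$, with the same index identifications and summations. $\mathbb{1}^{\otimes D}$ is the $N^D\times N^D$ identity matrix, and $J\otimes\bar J$ is viewed as an $N^D\times N^D$ matrix.
   Formalization: Signs and normalization corrected, as the printed formulas fail: V carries an extra factor (-1)^n, and the source term is +N^{-(D-1)} Tr[(J⊗J̄)(1+M̄)^{-1}]. "Formally" means ln and inverse are expanded in powers of M̄ and integrated term by term; (J⊗J̄)_{I;K} is J̄_I J_K. *)

theory Defs
  imports "HOL-Analysis.Analysis" "HOL-Computational_Algebra.Formal_Power_Series"
begin

text \<open>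
  Throughout, the type \<open>'d\<close> is the set of colours, so \<open>D = CARD('d)\<close>, and the type \<open>'n\<close> is the
  common range of all tensor indices, so \<open>N = CARD('n)\<close>.  A multi-index \<open>(i\<^sub>1, \<dots>, i\<^sub>D)\<close> is a function
  \<open>'d \<Rightarrow> 'n\<close>; there are \<open>N ^ D\<close> of them.
\<close>

section \<open>Bubbles and pairings\<close>

text \<open>
  An edge is a triple (white end, black end, colour).  Multiple edges between two vertices are
  allowed; in a proper edge-colouring they carry distinct colours, so a set of triples suffices.
\<close>

record ('v, 'd) coloured_graph =
  whites :: "'v set"
  blacks :: "'v set"
  edges  :: "('v \<times> 'v \<times> 'd) set"

definition vertices :: "('v, 'd) coloured_graph \<Rightarrow> 'v set" where
  "vertices B = whites B \<union> blacks B"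

definition incident :: "'v \<Rightarrow> 'v \<times> 'v \<times> 'd \<Rightarrow> bool" where
  "incident v e \<longleftrightarrow> v = fst e \<or> v = fst (snd e)"

definition colour :: "'v \<times> 'v \<times> 'd \<Rightarrow> 'd" where
  "colour e = snd (snd e)"

definition adjacency :: "('v, 'd) coloured_graph \<Rightarrow> ('v \<times> 'v) set" where
  "adjacency B = {(u, v). \<exists>e \<in> edges B. u \<noteq> v \<and> incident u e \<and> incident v e}"

definition bubble :: "('v, 'd :: finite) coloured_graph \<Rightarrow> bool" where
  "bubble B \<longleftrightarrow>
     finite (vertices B) \<and> vertices B \<noteq> {} \<and>
     whites B \<inter> blacks B = {} \<and>
     edges B \<subseteq> whites B \<times> blacks B \<times> UNIV \<and>
     (\<forall>v \<in> vertices B. card {e \<in> edges B. incident v e} = CARD('d)) \<and>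
     (\<forall>v \<in> vertices B. inj_on colour {e \<in> edges B. incident v e}) \<and>
     (\<forall>u \<in> vertices B. \<forall>v \<in> vertices B. (u, v) \<in> (adjacency B)\<^sup>*)"

definition pairing :: "('v, 'd) coloured_graph \<Rightarrow> ('v \<Rightarrow> 'v) \<Rightarrow> bool" where
  "pairing B \<Omega> \<longleftrightarrow> bij_betw \<Omega> (whites B) (blacks B)"

section \<open>Tensors, matrices and their invariants\<close>

type_synonym ('d, 'n) tensor = "complex ^ ('d \<Rightarrow> 'n)"
type_synonym ('d, 'n) tmatrix = "complex ^ ('d \<Rightarrow> 'n) ^ ('d \<Rightarrow> 'n)"

definition vec_cnj :: "complex ^ 'i \<Rightarrow> complex ^ 'i" where
  "vec_cnj T = (\<chi> I. cnj (T $ I))"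

definition mat_cnj :: "complex ^ 'k ^ 'i \<Rightarrow> complex ^ 'k ^ 'i" where
  "mat_cnj M = (\<chi> I K. cnj (M $ I $ K))"

definition tdot :: "complex ^ 'i \<Rightarrow> complex ^ 'i \<Rightarrow> complex" where
  "tdot S T = (\<Sum>I\<in>UNIV. S $ I * T $ I)"

text \<open>
  An index assignment gives a multi-index to every vertex, such that the two ends of an edge of
  colour \<open>c\<close> agree in their \<open>c\<close>-th index.
\<close>

definition assignments :: "('v, 'd :: finite) coloured_graph \<Rightarrow> ('v \<Rightarrow> 'd \<Rightarrow> 'n :: finite) set" where
  "assignments B =
     {x \<in> vertices B \<rightarrow>\<^sub>E UNIV. \<forall>(a, b, c) \<in> edges B. x a c = x b c}"

definition bubble_trace ::
    "('v, 'd :: finite) coloured_graph \<Rightarrow> ('d, 'n :: finite) tensor \<Rightarrow> ('d, 'n) tensor \<Rightarrow> complex" where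
  "bubble_trace B T T' =
     (\<Sum>x \<in> assignments B. (\<Prod>a \<in> whites B. T $ x a) * (\<Prod>b \<in> blacks B. T' $ x b))"

definition matrix_bubble ::
    "('v, 'd :: finite) coloured_graph \<Rightarrow> ('v \<Rightarrow> 'v) \<Rightarrow> ('d, 'n :: finite) tmatrix \<Rightarrow> complex" where
  "matrix_bubble B \<Omega> M = (\<Sum>x \<in> assignments B. \<Prod>a \<in> whites B. M $ x a $ x (\<Omega> a))"

text \<open>
  The tensor product of \<open>J\<close> and its conjugate, as a matrix.  The conjugate carries the row
  index.  Indeed the first index of \<open>mat_cnj M\<close> transforms like the conjugate of \<open>T\<close> and the second
  one like \<open>T\<close>, and only with this choice is
  \<open>trace (source_matrix J ** matrix_inv (mat 1 + mat_cnj M))\<close> invariant under unitary changes of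
  basis.
\<close>

definition source_matrix :: "complex ^ 'i \<Rightarrow> complex ^ 'i ^ 'i" where
  "source_matrix J = (\<chi> I K. cnj (J $ I) * J $ K)"

section \<open>Gaussian measures\<close>

definition tensor_gaussian :: "('d :: finite, 'n :: finite) tensor measure" where
  "tensor_gaussian =
     (let w = (\<lambda>T :: ('d, 'n) tensor.
                 exp (- (real CARD('n) ^ (CARD('d) - 1) * Re (tdot T (vec_cnj T)))))
      in density lborel (\<lambda>T. ennreal (w T / (LINT S|lborel. w S))))"

definition matrix_gaussian :: "('d :: finite, 'n :: finite) tmatrix measure" where
  "matrix_gaussian =
     density lborel (\<lambda>M. ennreal
       (exp (- Re (\<Sum>I\<in>UNIV. \<Sum>K\<in>UNIV. M $ I $ K * mat_cnj M $ I $ K))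
        / pi ^ (CARD('n) ^ (2 * CARD('d)))))"

section \<open>Formal series and formal integrals\<close>

text \<open>
  For a scalar series \<open>f\<close>, this is the trace of \<open>P f(t A)\<close>, as a formal power series in \<open>t\<close>.
\<close>

definition trace_series :: "complex fps \<Rightarrow> complex ^ 'i ^ 'i \<Rightarrow> complex ^ 'i ^ 'i \<Rightarrow> complex fps" where
  "trace_series f P A = Abs_fps (\<lambda>j. fps_nth f j * trace (P ** (((**) A ^^ j) (mat 1))))"

definition tr_ln_one_plus :: "complex ^ 'i ^ 'i \<Rightarrow> complex fps" where
  "tr_ln_one_plus A = trace_series (fps_ln 1) (mat 1) A"

definition tr_resolvent :: "complex ^ 'i ^ 'i \<Rightarrow> complex ^ 'i ^ 'i \<Rightarrow> complex fps" where
  "tr_resolvent P A = trace_series (inverse (1 + fps_X)) P A"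

text \<open>
  The exponential of a formal series.  Composition with \<open>fps_exp 1\<close> is only meaningful for a
  vanishing constant term, which is therefore split off.
\<close>

definition formal_exp :: "complex fps \<Rightarrow> complex fps" where
  "formal_exp f =
     fps_const (exp (fps_nth f 0)) * (fps_exp 1 oo (f - fps_const (fps_nth f 0)))"

text \<open>
  Formal integration: \<open>F x k\<close> is the coefficient of \<open>\<lambda> ^ k\<close> of the integrand at \<open>x\<close>, and \<open>Z\<close> is the
  resulting formal power series in \<open>\<lambda>\<close>.
\<close>

definition has_formal_integral ::
    "'a measure \<Rightarrow> ('a \<Rightarrow> nat \<Rightarrow> complex) \<Rightarrow> complex fps \<Rightarrow> bool" where
  "has_formal_integral \<mu> F Z \<longleftrightarrow> (\<forall>k. has_bochner_integral \<mu> (\<lambda>x. F x k) (fps_nth Z k))"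

text \<open>
  The logarithm and the inverse of \<open>mat 1 + mat_cnj M\<close> are expanded in powers of \<open>mat_cnj M\<close>, and
  the Gaussian integral is taken term by term: \<open>F M k m\<close> is the part of the coefficient of
  \<open>\<lambda> ^ k\<close> of degree \<open>m\<close> in \<open>mat_cnj M\<close>.  This is not the integral of the coefficient of \<open>\<lambda> ^ k\<close> as
  a function of \<open>M\<close>: for a matrix of size 1, the integral of \<open>M / (1 + mat_cnj M)\<close> converges, but
  to \<open>2 / exp 1 - 1\<close> instead of \<open>- 1\<close>.
\<close>

definition has_graded_formal_integral ::
    "'a measure \<Rightarrow> ('a \<Rightarrow> nat \<Rightarrow> nat \<Rightarrow> complex) \<Rightarrow> complex fps \<Rightarrow> bool" where
  "has_graded_formal_integral \<nu> F Z \<longleftrightarrow>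
     (\<forall>k m. integrable \<nu> (\<lambda>x. F x k m)) \<and>
     (\<forall>k. ((\<lambda>m. LINT x|\<nu>. F x k m) has_sum fps_nth Z k) UNIV)"

section \<open>The integrands\<close>

text \<open>
  The exponentials are split into the part depending on \<open>\<lambda>\<close>, whose exponent is linear in \<open>\<lambda>\<close>, and
  the rest.
\<close>

definition tensor_integrand ::
    "('v, 'd :: finite) coloured_graph \<Rightarrow> nat \<Rightarrow> real \<Rightarrow> ('d, 'n :: finite) tensor \<Rightarrow> nat \<Rightarrow> complex" where
  "tensor_integrand B n s T k =
     fps_nth (fps_exp (- (of_real (real CARD('n) powr s) / of_nat n
                          * bubble_trace B T (vec_cnj T)))) k"

definition tensor_source_integrand ::
    "('v, 'd :: finite) coloured_graph \<Rightarrow> nat \<Rightarrow> real \<Rightarrow> ('d, 'n :: finite) tensor \<Rightarrow>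
     ('d, 'n) tensor \<Rightarrow> nat \<Rightarrow> complex" where
  "tensor_source_integrand B n s J T k =
     tensor_integrand B n s T k * exp (- tdot (vec_cnj J) T - tdot (vec_cnj T) J)"

text \<open>
  The sign \<open>(- 1) ^ n\<close> is needed because the expansion of \<open>1 / det (mat 1 + mat_cnj M)\<close> couples
  \<open>- T I * cnj (T K)\<close> to the conjugate of \<open>M $ I $ K\<close>, and \<open>matrix_bubble\<close> is homogeneous of
  degree \<open>n\<close>.
\<close>

definition matrix_interaction ::
    "('v, 'd :: finite) coloured_graph \<Rightarrow> ('v \<Rightarrow> 'v) \<Rightarrow> nat \<Rightarrow> real \<Rightarrow> ('d, 'n :: finite) tmatrix \<Rightarrow>
     complex fps" where
  "matrix_interaction B \<Omega> n s M =
     fps_exp (- ((- 1) ^ n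
                 * of_real (real CARD('n) powr (s - real n * (real CARD('d) - 1))) / of_nat n
                 * matrix_bubble B \<Omega> M))"

definition matrix_integrand ::
    "('v, 'd :: finite) coloured_graph \<Rightarrow> ('v \<Rightarrow> 'v) \<Rightarrow> nat \<Rightarrow> real \<Rightarrow> ('d, 'n :: finite) tmatrix \<Rightarrow>
     nat \<Rightarrow> nat \<Rightarrow> complex" where
  "matrix_integrand B \<Omega> n s M k m =
     fps_nth (matrix_interaction B \<Omega> n s M) k *
     fps_nth (formal_exp (- tr_ln_one_plus (mat_cnj M))) m"

text \<open>
  The sign of the source term and its factor \<open>N ^ (D - 1)\<close> are those of the Gaussian integral: for
  \<open>\<lambda> = 0\<close>, the integral of \<open>exp (- tdot (vec_cnj J) T - tdot (vec_cnj T) J)\<close> is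
  \<open>exp (tdot (vec_cnj J) J / N ^ (D - 1))\<close>.
\<close>

definition matrix_source_integrand ::
    "('v, 'd :: finite) coloured_graph \<Rightarrow> ('v \<Rightarrow> 'v) \<Rightarrow> nat \<Rightarrow> real \<Rightarrow> ('d, 'n :: finite) tensor \<Rightarrow>
     ('d, 'n) tmatrix \<Rightarrow> nat \<Rightarrow> nat \<Rightarrow> complex" where
  "matrix_source_integrand B \<Omega> n s J M k m =
     fps_nth (matrix_interaction B \<Omega> n s M) k *
     fps_nth (formal_exp (- tr_ln_one_plus (mat_cnj M)
       + fps_const (1 / of_nat (CARD('n) ^ (CARD('d) - 1)))
         * tr_resolvent (source_matrix J) (mat_cnj M))) m"

end

theory Submission
  imports Defs "HOL-Probability.Distributions"
begin

text \<open>
  Put \<open>c = N ^ (D - 1)\<close> and \<open>Q A T = (\<Sum>K I. A $ K $ I * T $ K * cnj (T $ I))\<close>.  Integration by parts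
  in the Gaussian variables \<open>T\<close> and \<open>cnj T\<close> shows that
  \<open>(\<Sum>m. (- c t) ^ m / m! * E (Q A T ^ m))\<close>, the expectation being taken with the source term, solves
  the same linear differential equation in \<open>t\<close> as
  \<open>exp (- Tr ln (1 + t A) + 1 / c * Tr ((J \<otimes> cnj J) (1 + t A) ^ -1))\<close>; the initial values agree by
  completing the square.  Take \<open>A = mat_cnj M\<close> and integrate over \<open>M\<close> first: for the Gaussian measure
  \<open>\<nu>\<close>, the pairing of a homogeneous polynomial \<open>p\<close> of degree \<open>m\<close> with
  \<open>(\<Sum>K I. X $ K $ I * cnj (M $ K $ I)) ^ m / m!\<close> is \<open>p X\<close>, and all other degrees give \<open>0\<close>.  Hence
  the coefficient of \<open>\<lambda> ^ k\<close> on the matrix side has the single contribution \<open>m = n k\<close>, in which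
  \<open>matrix_bubble\<close> is evaluated at \<open>- c T $ K * cnj (T $ I)\<close>, where it is a multiple of \<open>bubble_trace\<close>.
\<close>

section \<open>Gaussian integrals of functions of polynomial growth\<close>

text \<open>Fubini in orthonormal coordinates: \<open>lborel\<close> is the image of the product of
  one-dimensional Lebesgue measures under the coordinate map \<open>?T\<close>.\<close>

lemma integral_lborel_prod_Basis:
  fixes f :: "'a::euclidean_space \<Rightarrow> real \<Rightarrow> real"
  assumes "\<And>b. b \<in> Basis \<Longrightarrow> integrable lborel (f b)"
  shows "has_bochner_integral lborel (\<lambda>x::'a. \<Prod>b\<in>Basis. f b (x \<bullet> b)) (\<Prod>b\<in>Basis. integral\<^sup>L lborel (f b))"
proof -
  interpret product_sigma_finite "\<lambda>b::'a. lborel :: real measure" ..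
  let ?T = "\<lambda>g. \<Sum>b\<in>Basis. g b *\<^sub>R b :: 'a"
  have "has_bochner_integral (\<Pi>\<^sub>M b\<in>Basis. lborel) (\<lambda>g. \<Prod>b\<in>(Basis::'a set). f b (?T g \<bullet> b))
      (\<Prod>b\<in>Basis. integral\<^sup>L lborel (f b))"
    using product_integrable_prod[OF finite_Basis assms] product_integral_prod[OF finite_Basis assms]
    by (simp add: has_bochner_integral_iff cong: prod.cong)
  moreover have "(\<lambda>x::'a. \<Prod>b\<in>Basis. f b (x \<bullet> b)) \<in> borel_measurable borel"
  proof (intro borel_measurable_prod)
    fix b :: 'a assume "b \<in> Basis"
    then have [measurable]: "f b \<in> borel_measurable borel" using assms[of b] by (auto dest: borel_measurable_integrable)
    show "(\<lambda>x. f b (x \<bullet> b)) \<in> borel_measurable borel" by measurable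
  qed
  ultimately show ?thesis
    by (subst lborel_eq) (intro has_bochner_integral_distr, auto)
qed

lemma gaussian_integral_real:
  fixes c :: real
  assumes "c > 0"
  shows "has_bochner_integral lborel (\<lambda>x. exp (- (c * x\<^sup>2))) (sqrt (pi / c))"
proof -
  define \<sigma> where "\<sigma> = sqrt (1 / (2 * c))"
  have s: "\<sigma> > 0" "\<sigma>\<^sup>2 = 1 / (2 * c)" using assms by (auto simp: \<sigma>_def)
  have *: "sqrt (pi / c) * normal_density 0 \<sigma> x = exp (- (c * x\<^sup>2))" for x
    using assms by (simp add: normal_density_def s)
  have "has_bochner_integral lborel (\<lambda>x. sqrt (pi / c) * normal_density 0 \<sigma> x) (sqrt (pi / c) * 1)"
    using s by (intro has_bochner_integral_mult_right) (auto simp: has_bochner_integral_iff)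
  then show ?thesis by (simp add: *)
qed

lemma gaussian_integral:
  fixes c :: real
  assumes "c > 0"
  shows "has_bochner_integral lborel (\<lambda>x::'a::euclidean_space. exp (- (c * (norm x)\<^sup>2))) (sqrt (pi / c) ^ DIM('a))"
proof -
  have *: "exp (- (c * (norm x)\<^sup>2)) = (\<Prod>b\<in>Basis. exp (- (c * (x \<bullet> b)\<^sup>2)))" for x :: 'a
    unfolding power2_norm_eq_inner euclidean_inner[of x x]
    by (simp add: exp_sum[symmetric] sum_distrib_left sum_negf power2_eq_square)
  have "has_bochner_integral lborel (\<lambda>x::'a. \<Prod>b\<in>Basis. exp (- (c * (x \<bullet> b)\<^sup>2)))
     (\<Prod>b\<in>(Basis::'a set). integral\<^sup>L lborel (\<lambda>x. exp (- (c * x\<^sup>2))))"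
    using gaussian_integral_real[OF assms]
    by (intro integral_lborel_prod_Basis) (auto simp: has_bochner_integral_iff)
  then show ?thesis
    using gaussian_integral_real[OF assms] by (simp add: * has_bochner_integral_iff)
qed

section \<open>Continuous functions of polynomial growth\<close>

definition poly_growth :: "('a::real_normed_vector \<Rightarrow> 'b::real_normed_algebra_1) \<Rightarrow> bool" where
  "poly_growth F \<longleftrightarrow> continuous_on UNIV F \<and> (\<exists>C k. \<forall>x. norm (F x) \<le> C * (1 + norm x) ^ k)"

lemma poly_growthI:
  assumes "continuous_on UNIV F" "\<And>x. norm (F x) \<le> C * (1 + norm x) ^ k"
  shows "poly_growth F"
  using assms unfolding poly_growth_def by blast

lemma poly_growthE:
  assumes "poly_growth F"
  obtains C k where "continuous_on UNIV F" "C \<ge> 0" "\<And>x. norm (F x) \<le> C * (1 + norm x) ^ k"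
proof -
  from assms obtain C k where *: "continuous_on UNIV F" "\<And>x. norm (F x) \<le> C * (1 + norm x) ^ k"
    unfolding poly_growth_def by blast
  have "C \<ge> 0" using order.trans[OF norm_ge_zero *(2)[of 0]] by simp
  with * that show ?thesis by blast
qed

lemma poly_growth_const: "poly_growth (\<lambda>_. a)"
  by (rule poly_growthI[where C="norm a" and k=0]) auto

lemma poly_growth_bounded_linear: "bounded_linear F \<Longrightarrow> poly_growth F"
proof -
  assume F: "bounded_linear F"
  then obtain K where K: "K \<ge> 0" "\<And>x. norm (F x) \<le> norm x * K"
    using bounded_linear.nonneg_bounded by blast
  show ?thesis
  proof (rule poly_growthI[where C=K and k=1])
    show "continuous_on UNIV F" by (intro linear_continuous_on F)
    show "norm (F x) \<le> K * (1 + norm x) ^ 1" for x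
      using K(1) K(2)[of x] by (simp add: algebra_simps)
  qed
qed

lemma poly_growth_add:
  assumes "poly_growth F" "poly_growth G"
  shows "poly_growth (\<lambda>x. F x + G x)"
proof -
  obtain C k where F: "continuous_on UNIV F" "C \<ge> 0" "\<And>x. norm (F x) \<le> C * (1 + norm x) ^ k"
    using poly_growthE[OF assms(1)] by blast
  obtain D l where G: "continuous_on UNIV G" "D \<ge> 0" "\<And>x. norm (G x) \<le> D * (1 + norm x) ^ l"
    using poly_growthE[OF assms(2)] by blast
  show ?thesis
  proof (rule poly_growthI[where C="C+D" and k="k+l"])
    show "continuous_on UNIV (\<lambda>x. F x + G x)" by (intro continuous_intros F G)
    fix x
    have "norm (F x + G x) \<le> norm (F x) + norm (G x)" by (rule norm_triangle_ineq)
    also have "\<dots> \<le> C * (1 + norm x) ^ k + D * (1 + norm x) ^ l" by (intro add_mono F G)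
    also have "\<dots> \<le> C * (1 + norm x) ^ (k+l) + D * (1 + norm x) ^ (k+l)"
      by (intro add_mono mult_left_mono power_increasing F G) auto
    finally show "norm (F x + G x) \<le> (C + D) * (1 + norm x) ^ (k+l)" by (simp add: algebra_simps)
  qed
qed

lemma poly_growth_mult:
  assumes "poly_growth F" "poly_growth G"
  shows "poly_growth (\<lambda>x. F x * G x)"
proof -
  obtain C k where F: "continuous_on UNIV F" "C \<ge> 0" "\<And>x. norm (F x) \<le> C * (1 + norm x) ^ k"
    using poly_growthE[OF assms(1)] by blast
  obtain D l where G: "continuous_on UNIV G" "D \<ge> 0" "\<And>x. norm (G x) \<le> D * (1 + norm x) ^ l"
    using poly_growthE[OF assms(2)] by blast
  show ?thesis
  proof (rule poly_growthI[where C="C*D" and k="k+l"])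
    show "continuous_on UNIV (\<lambda>x. F x * G x)" by (intro continuous_intros F G)
    fix x
    have "norm (F x * G x) \<le> norm (F x) * norm (G x)" by (rule norm_mult_ineq)
    also have "\<dots> \<le> (C * (1 + norm x) ^ k) * (D * (1 + norm x) ^ l)"
      using F G by (intro mult_mono F G) auto
    finally show "norm (F x * G x) \<le> (C * D) * (1 + norm x) ^ (k+l)" by (simp add: power_add algebra_simps)
  qed
qed

lemma poly_growth_sum: "(\<And>i. i \<in> S \<Longrightarrow> poly_growth (F i)) \<Longrightarrow> poly_growth (\<lambda>x. \<Sum>i\<in>S. F i x)"
  by (induction S rule: infinite_finite_induct) (auto intro: poly_growth_const poly_growth_add poly_growth_mult)

lemma poly_growth_prod:
  fixes F :: "'i \<Rightarrow> 'a::real_normed_vector \<Rightarrow> 'b::{real_normed_algebra_1, comm_monoid_mult}"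
  shows "(\<And>i. i \<in> S \<Longrightarrow> poly_growth (F i)) \<Longrightarrow> poly_growth (\<lambda>x. \<Prod>i\<in>S. F i x)"
  by (induction S rule: infinite_finite_induct) (auto intro: poly_growth_const poly_growth_add poly_growth_mult)

lemma poly_growth_power: "poly_growth F \<Longrightarrow> poly_growth (\<lambda>x. F x ^ m)"
  by (induction m) (auto intro: poly_growth_const poly_growth_mult)

lemmas poly_growth_intros = poly_growth_const poly_growth_add poly_growth_mult poly_growth_sum
  poly_growth_prod poly_growth_power

lemma poly_growth_compose_linear:
  assumes "poly_growth F" "bounded_linear g"
  shows "poly_growth (\<lambda>x. F (g x))"
proof -
  obtain C k where F: "continuous_on UNIV F" "C \<ge> 0" "\<And>x. norm (F x) \<le> C * (1 + norm x) ^ k"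
    using poly_growthE[OF assms(1)] by blast
  obtain K where K: "K \<ge> 0" "\<And>x. norm (g x) \<le> norm x * K"
    using bounded_linear.nonneg_bounded[OF assms(2)] by blast
  show ?thesis
  proof (rule poly_growthI[where C="C * (1 + K) ^ k" and k=k])
    show "continuous_on UNIV (\<lambda>x. F (g x))"
      by (rule continuous_on_compose2[OF F(1)]) (auto intro: linear_continuous_on assms)
    fix x
    have "norm (F (g x)) \<le> C * (1 + norm (g x)) ^ k" by (rule F)
    also have "\<dots> \<le> C * ((1 + K) * (1 + norm x)) ^ k"
    proof (intro mult_left_mono power_mono F)
      show "1 + norm (g x) \<le> (1 + K) * (1 + norm x)"
      proof -
        have "norm (g x) \<le> norm x * K" by (rule K)
        also have "\<dots> \<le> norm x * K + (K + norm x)" using K(1) norm_ge_zero[of x] by linarith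
        finally show ?thesis by (simp add: algebra_simps)
      qed
    qed auto
    finally show "norm (F (g x)) \<le> C * (1 + K) ^ k * (1 + norm x) ^ k" by (simp add: power_mult_distrib)
  qed
qed

text \<open>The linear term carries the sources, so that a Gaussian with source stays in the same
  family; for a tensor source \<open>J\<close> it is \<open>-2 *\<^sub>R J\<close>.\<close>

definition gauss_weight :: "real \<Rightarrow> 'a::real_inner \<Rightarrow> 'a \<Rightarrow> real" where
  "gauss_weight c l x = exp (l \<bullet> x - c * (norm x)\<^sup>2)"

lemma continuous_on_gauss_weight [continuous_intros]: "continuous_on A (gauss_weight c l)"
  unfolding gauss_weight_def by (intro continuous_intros)

lemma gauss_weight_pos: "gauss_weight c l x > 0"
  by (simp add: gauss_weight_def)

text \<open>This is what the class \<open>poly_growth\<close> is for: it is closed under sums,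
  products and linear substitutions, and one bound makes all its members integrable. The polynomial
  factor is at most an exponential of the norm, and half of the quadratic exponent absorbs all
  linear terms, so a Gaussian with parameter \<open>c / 2\<close> dominates.\<close>

lemma poly_growth_gauss_weight_integrable:
  fixes F :: "'a::euclidean_space \<Rightarrow> complex"
  assumes c: "c > 0" and "poly_growth F"
  shows "integrable lborel (\<lambda>x. of_real (gauss_weight c l x) * F x)"
proof -
  obtain C k where F: "continuous_on UNIV F" "C \<ge> 0" "\<And>x. norm (F x) \<le> C * (1 + norm x) ^ k"
    using poly_growthE[OF assms(2)] by blast
  \<comment> \<open>\<open>fact k\<close> comes from bounding a single term of the exponential
    series; \<open>(1 + norm l)\<^sup>2 / (2 * c)\<close> is the maximum of
    \<open>(1 + norm l) * r - c / 2 * r\<^sup>2\<close> over real \<open>r\<close>.\<close>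
  define D where "D = C * (fact k * exp (1 + (1 + norm l)\<^sup>2 / (2 * c)))"
  have meas: "(\<lambda>x. complex_of_real (gauss_weight c l x) * F x) \<in> borel_measurable borel"
    by (intro borel_measurable_continuous_onI continuous_intros F)
  have bound: "norm (complex_of_real (gauss_weight c l x) * F x) \<le> D * exp (- (c / 2 * (norm x)\<^sup>2))" for x
  proof -
    have "(1 + norm x) ^ k / fact k \<le> exp (1 + norm x)"
    proof -
      have "(\<Sum>i\<in>{k}. (1 + norm x) ^ i /\<^sub>R fact i) \<le> exp (1 + norm x)"
        unfolding exp_def by (rule sum_le_suminf[OF summable_exp_generic]) auto
      then show ?thesis by (simp add: divide_inverse mult.commute)
    qed
    then have 1: "(1 + norm x) ^ k \<le> fact k * exp (1 + norm x)" by (simp add: field_simps)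
    have 2: "gauss_weight c l x \<le> exp (norm l * norm x - c * (norm x)\<^sup>2)"
      unfolding gauss_weight_def using norm_cauchy_schwarz[of l x] by simp
    have "norm (complex_of_real (gauss_weight c l x) * F x) = gauss_weight c l x * norm (F x)"
      by (simp add: norm_mult gauss_weight_def)
    also have "\<dots> \<le> exp (norm l * norm x - c * (norm x)\<^sup>2) * (C * (fact k * exp (1 + norm x)))"
      by (intro mult_mono 2 order.trans[OF F(3)] mult_left_mono 1) (use F in auto)
    also have "\<dots> = C * (fact k * exp (1 + (1 + norm l) * norm x - c * (norm x)\<^sup>2))"
      by (simp add: exp_add exp_diff algebra_simps)
    also have "\<dots> \<le> C * (fact k * exp (1 + (1 + norm l)\<^sup>2 / (2 * c) - (c / 2 * (norm x)\<^sup>2)))"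
    proof (intro mult_left_mono F)
      have "0 \<le> (c * norm x - (1 + norm l))\<^sup>2 / (2 * c)" using c by simp
      also have "\<dots> = (1 + norm l)\<^sup>2 / (2 * c) - (1 + norm l) * norm x + c / 2 * (norm x)\<^sup>2"
        using c by (simp add: power2_diff field_simps power2_eq_square)
      finally show "exp (1 + (1 + norm l) * norm x - c * (norm x)\<^sup>2) \<le> exp (1 + (1 + norm l)\<^sup>2 / (2 * c) - (c / 2 * (norm x)\<^sup>2))"
        by (simp add: algebra_simps)
    qed auto
    also have "\<dots> = D * exp (- (c / 2 * (norm x)\<^sup>2))"
      unfolding D_def by (simp add: exp_add[symmetric] mult.assoc)
    finally show ?thesis .
  qed
  have "integrable lborel (\<lambda>x::'a. D * exp (- (c / 2 * (norm x)\<^sup>2)))"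
    using gaussian_integral[of "c / 2", where 'a='a] c by (simp add: has_bochner_integral_iff)
  then show ?thesis
    by (rule Bochner_Integration.integrable_bound) (use meas in \<open>auto intro!: AE_I2 order.trans[OF bound]\<close>)
qed

section \<open>Translation invariance and integration by parts\<close>

lemma integral_lborel_translate:
  fixes f :: "'a::euclidean_space \<Rightarrow> 'b::{banach, second_countable_topology}"
  assumes "f \<in> borel_measurable borel"
  shows "integral\<^sup>L lborel (\<lambda>x. f (a + x)) = integral\<^sup>L lborel f"
proof -
  have "integral\<^sup>L lborel f = integral\<^sup>L (distr lborel borel ((+) a)) f"
    by (simp add: lborel_distr_plus)
  also have "\<dots> = integral\<^sup>L lborel (\<lambda>x. f (a + x))"
    using assms by (intro integral_distr) auto
  finally show ?thesis ..
qed

lemma integrable_lborel_translate: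
  fixes f :: "'a::euclidean_space \<Rightarrow> 'b::{banach, second_countable_topology}"
  assumes "integrable lborel f"
  shows "integrable lborel (\<lambda>x. f (a + x))"
proof -
  have "integrable (distr lborel borel ((+) a)) f" using assms by (simp add: lborel_distr_plus)
  then show ?thesis by (rule integrable_distr[rotated]) auto
qed

text \<open>Average the derivative over a unit segment: by the fundamental theorem of calculus this gives
  the difference of two translates, and the integral is translation invariant.\<close>

lemma integral_directional_derivative_eq_0:
  fixes g g' :: "'a::euclidean_space \<Rightarrow> complex"
  assumes g: "integrable lborel g" and g': "integrable lborel g'" and cont: "continuous_on UNIV g'"
    and deriv: "\<And>x t. ((\<lambda>t. g (t *\<^sub>R e + x)) has_vector_derivative g' (t *\<^sub>R e + x)) (at t)"
  shows "integral\<^sup>L lborel g' = 0"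
proof -
  \<comment> \<open>The indicator makes \<open>h\<close> a function on the whole product space, so
    that Fubini's theorem exchanges the average over \<open>t\<close> with the integral over
    \<open>x\<close>.\<close>
  define h where "h = (\<lambda>t x. indicator {0..1::real} t *\<^sub>R g' (t *\<^sub>R e + x))"
  have meas_g': "g' \<in> borel_measurable borel" using cont by (rule borel_measurable_continuous_onI)
  have meas_g: "g \<in> borel_measurable borel" using g by auto
  have nrm: "(LINT y|lborel. norm (h t y)) = indicator {0..1} t * integral\<^sup>L lborel (\<lambda>x. norm (g' x))" for t
    unfolding h_def using integral_lborel_translate[of "\<lambda>x. norm (g' x)" "t *\<^sub>R e"] meas_g'
    by (auto simp: indicator_def)
  have int: "integrable (lborel \<Otimes>\<^sub>M lborel) (case_prod h)"
  proof (rule lborel_pair.Fubini_integrable)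
    have "continuous_on UNIV (\<lambda>p :: real \<times> 'a. g' (fst p *\<^sub>R e + snd p))"
      by (rule continuous_on_compose2[OF cont]) (auto intro!: continuous_intros)
    then have [measurable]: "(\<lambda>p :: real \<times> 'a. g' (fst p *\<^sub>R e + snd p)) \<in> borel_measurable borel"
      by (rule borel_measurable_continuous_onI)
    have [measurable]: "(\<lambda>p :: real \<times> 'a. indicator {0..1} (fst p) :: real) \<in> borel_measurable borel"
      by (simp add: borel_prod[symmetric])
    show "case_prod h \<in> borel_measurable (lborel \<Otimes>\<^sub>M lborel)"
      unfolding h_def case_prod_unfold lborel_prod by simp
    show "integrable lborel (\<lambda>t. LINT y|lborel. norm (case_prod h (t, y)))"
      by (simp add: nrm)
    show "AE t in lborel. integrable lborel (\<lambda>y. case_prod h (t, y))"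
      using integrable_lborel_translate[OF g'] by (auto simp: h_def)
  qed
  have inner: "(LINT t|lborel. h t x) = g (e + x) - g x" for x
  proof -
    have "(LINT t|lborel. h t x) = g (1 *\<^sub>R e + x) - g (0 *\<^sub>R e + x)"
      unfolding h_def
    proof (rule integral_FTC_atLeastAtMost)
      show "((\<lambda>t. g (t *\<^sub>R e + x)) has_vector_derivative g' (t *\<^sub>R e + x)) (at t within {0..1})" for t
        using deriv by (rule has_vector_derivative_at_within)
      show "continuous_on {0..1} (\<lambda>t. g' (t *\<^sub>R e + x))"
        by (rule continuous_on_compose2[OF cont]) (auto intro!: continuous_intros)
    qed auto
    then show ?thesis by simp
  qed
  have "(LINT t|lborel. LINT x|lborel. h t x) = integral\<^sup>L lborel g'"
  proof -
    have "(LINT x|lborel. h t x) = indicator {0..1} t *\<^sub>R integral\<^sup>L lborel g'" for t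
      unfolding h_def using integral_lborel_translate[OF meas_g'] by simp
    then show ?thesis by simp
  qed
  moreover have "(LINT x|lborel. LINT t|lborel. h t x) = 0"
    unfolding inner using integrable_lborel_translate[OF g] g integral_lborel_translate[OF meas_g]
    by simp
  ultimately show ?thesis using lborel_pair.Fubini_integral[OF int] by simp
qed

text \<open>The derivative of the weight times \<open>F\<close> along \<open>e\<close> integrates to
  \<open>0\<close>; differentiating the weight multiplies it by
  \<open>l \<bullet> e - 2 * c * (x \<bullet> e)\<close>.\<close>

lemma gauss_integral_by_parts:
  fixes F :: "'a::euclidean_space \<Rightarrow> complex"
  assumes c: "c > 0" and F: "poly_growth F" and F': "poly_growth (\<lambda>x. F' x e)"
    and deriv: "\<And>x. (F has_derivative F' x) (at x)"
  shows "(LINT x|lborel. of_real (gauss_weight c l x) * F' x e) =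
    (LINT x|lborel. of_real (gauss_weight c l x) * (of_real (2 * c * (x \<bullet> e) - l \<bullet> e) * F x))"
proof -
  define g where "g = (\<lambda>x. complex_of_real (gauss_weight c l x) * F x)"
  have lin: "poly_growth (\<lambda>x. complex_of_real (2 * c * (x \<bullet> e) - l \<bullet> e))"
  proof -
    have "poly_growth (\<lambda>x. complex_of_real (2 * c * (x \<bullet> e)) + complex_of_real (- (l \<bullet> e)))"
      by (intro poly_growth_add poly_growth_const poly_growth_bounded_linear)
        (auto intro!: bounded_linear_const_mult bounded_linear_of_real bounded_linear_inner_left
          bounded_linear_compose[OF bounded_linear_of_real, of "\<lambda>x. x \<bullet> e"])
    then show ?thesis by simp
  qed
  let ?G = "\<lambda>x. of_real (2 * c * (x \<bullet> e) - l \<bullet> e) * F x"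
  have G: "poly_growth ?G" using lin F by (rule poly_growth_mult)
  let ?g' = "\<lambda>x. complex_of_real (gauss_weight c l x) * F' x e - complex_of_real (gauss_weight c l x) * ?G x"
  note int = poly_growth_gauss_weight_integrable[OF c]
  have "integral\<^sup>L lborel ?g' = 0"
  proof (rule integral_directional_derivative_eq_0)
    show "integrable lborel g" unfolding g_def by (rule int[OF F])
    show "integrable lborel ?g'" by (intro Bochner_Integration.integrable_diff int F' G)
    show "continuous_on UNIV ?g'"
      using F F' unfolding poly_growth_def by (intro continuous_intros) auto
    have w: "((\<lambda>x. complex_of_real (gauss_weight c l x)) has_derivative
        (\<lambda>h. of_real (gauss_weight c l x * (l \<bullet> h - 2 * c * (x \<bullet> h))))) (at x)" for x
      unfolding gauss_weight_def power2_norm_eq_inner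
      by (auto intro!: derivative_eq_intros simp: inner_commute algebra_simps)
    fix x t
    have "((\<lambda>t. t *\<^sub>R e + x) has_vector_derivative e) (at t)"
      by (auto intro!: derivative_eq_intros)
    moreover have "(g has_derivative (\<lambda>h. complex_of_real (gauss_weight c l y) * F' y h +
        of_real (gauss_weight c l y * (l \<bullet> h - 2 * c * (y \<bullet> h))) * F y)) (at y)" for y
      unfolding g_def by (rule has_derivative_mult[OF w deriv])
    ultimately have "(g \<circ> (\<lambda>t. t *\<^sub>R e + x) has_vector_derivative
        (\<lambda>h. complex_of_real (gauss_weight c l (t *\<^sub>R e + x)) * F' (t *\<^sub>R e + x) h +
        of_real (gauss_weight c l (t *\<^sub>R e + x) * (l \<bullet> h - 2 * c * ((t *\<^sub>R e + x) \<bullet> h))) * F (t *\<^sub>R e + x)) e) (at t)"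
      by (intro vector_derivative_diff_chain_within) (auto intro: has_derivative_at_withinI)
    then show "((\<lambda>t. g (t *\<^sub>R e + x)) has_vector_derivative ?g' (t *\<^sub>R e + x)) (at t)"
      by (simp add: o_def algebra_simps)
  qed
  then show ?thesis
    by (subst (asm) Bochner_Integration.integral_diff) (use int[OF F'] int[OF G] in auto)
qed

text \<open>Normalisation is postponed: the total mass stays an explicit factor
  \<open>gauss_integral c 0 (\<lambda>_. 1)\<close> until the densities of the two measures come
  in.\<close>

definition gauss_integral :: "real \<Rightarrow> 'a::euclidean_space \<Rightarrow> ('a \<Rightarrow> complex) \<Rightarrow> complex" where
  "gauss_integral c l F = (LINT x|lborel. of_real (gauss_weight c l x) * F x)"

lemma gauss_integral_add:
  assumes "c > 0" "poly_growth F" "poly_growth G"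
  shows "gauss_integral c l (\<lambda>x. F x + G x) = gauss_integral c l F + gauss_integral c l G"
  unfolding gauss_integral_def
  by (simp add: distrib_left Bochner_Integration.integral_add poly_growth_gauss_weight_integrable assms)

lemma gauss_integral_mult_left: "gauss_integral c l (\<lambda>x. a * F x) = a * gauss_integral c l F"
  unfolding gauss_integral_def
  by (simp add: mult.left_commute[of _ a] flip: integral_mult_right_zero)

lemma gauss_integral_sum:
  assumes "c > 0" "\<And>i. i \<in> S \<Longrightarrow> poly_growth (F i)"
  shows "gauss_integral c l (\<lambda>x. \<Sum>i\<in>S. F i x) = (\<Sum>i\<in>S. gauss_integral c l (F i))"
  using assms(2)
proof (induction S rule: infinite_finite_induct)
  case (insert i S)
  then show ?case
    by (subst sum.insert) (auto simp: gauss_integral_add[OF assms(1)] poly_growth_sum)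
qed (auto simp: gauss_integral_def)

text \<open>With \<open>u\<close> and \<open>v\<close> the real and imaginary directions of one
  complex coordinate, \<open>\<zeta> = \<i>\<close> yields twice the derivative in the conjugate
  coordinate and \<open>\<zeta> = - \<i>\<close> twice the one in the coordinate itself.\<close>

lemma gauss_integral_by_parts_complex:
  fixes F :: "'a::euclidean_space \<Rightarrow> complex"
  assumes c: "c > 0" and F: "poly_growth F"
    and F': "poly_growth (\<lambda>x. F' x u)" "poly_growth (\<lambda>x. F' x v)"
    and deriv: "\<And>x. (F has_derivative F' x) (at x)"
  shows "gauss_integral c l (\<lambda>x. F' x u + \<zeta> * F' x v) =
    gauss_integral c l (\<lambda>x. (2 * of_real c * (of_real (x \<bullet> u) + \<zeta> * of_real (x \<bullet> v)) - (of_real (l \<bullet> u) + \<zeta> * of_real (l \<bullet> v))) * F x)"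
proof -
  have lin: "poly_growth (\<lambda>x. of_real (2 * c * (x \<bullet> e) - l \<bullet> e) * F x)" for e
  proof -
    have "poly_growth (\<lambda>x. (complex_of_real (2 * c * (x \<bullet> e)) + complex_of_real (- (l \<bullet> e))) * F x)"
      by (intro poly_growth_add poly_growth_const poly_growth_mult F poly_growth_bounded_linear)
        (auto intro!: bounded_linear_const_mult bounded_linear_of_real bounded_linear_inner_left
          bounded_linear_compose[OF bounded_linear_of_real, of "\<lambda>x. x \<bullet> e"])
    then show ?thesis by simp
  qed
  have "gauss_integral c l (\<lambda>x. F' x u + \<zeta> * F' x v) =
      gauss_integral c l (\<lambda>x. of_real (2 * c * (x \<bullet> u) - l \<bullet> u) * F x) +
      \<zeta> * gauss_integral c l (\<lambda>x. of_real (2 * c * (x \<bullet> v) - l \<bullet> v) * F x)"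
    unfolding gauss_integral_add[OF c F'(1) poly_growth_mult[OF poly_growth_const F'(2)]] gauss_integral_mult_left
    unfolding gauss_integral_def
    using gauss_integral_by_parts[OF c F F'(1) deriv, of l] gauss_integral_by_parts[OF c F F'(2) deriv, of l]
    by simp
  also have "\<dots> = gauss_integral c l (\<lambda>x. of_real (2 * c * (x \<bullet> u) - l \<bullet> u) * F x +
      \<zeta> * (of_real (2 * c * (x \<bullet> v) - l \<bullet> v) * F x))"
    unfolding gauss_integral_add[OF c lin poly_growth_mult[OF poly_growth_const lin]] gauss_integral_mult_left ..
  also have "\<dots> = gauss_integral c l (\<lambda>x. (2 * of_real c * (of_real (x \<bullet> u) + \<zeta> * of_real (x \<bullet> v)) - (of_real (l \<bullet> u) + \<zeta> * of_real (l \<bullet> v))) * F x)"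
    by (simp add: algebra_simps)
  finally show ?thesis .
qed

lemma gauss_integral_1:
  assumes "c > 0"
  shows "gauss_integral c 0 (\<lambda>_::'a::euclidean_space. 1) = of_real (sqrt (pi / c) ^ DIM('a))"
  using gaussian_integral[OF assms, where 'a='a] unfolding gauss_integral_def gauss_weight_def
  by (simp add: has_bochner_integral_iff flip: of_real_power)

text \<open>Completing the square: the weight is a constant times the centred one translated by
  \<open>l /\<^sub>R (2 * c)\<close>, and Lebesgue measure is translation invariant.\<close>

lemma gauss_integral_1_source:
  fixes l :: "'a::euclidean_space"
  assumes "c > 0"
  shows "gauss_integral c l (\<lambda>_. 1) = of_real (exp ((norm l)\<^sup>2 / (4 * c))) * gauss_integral c 0 (\<lambda>_::'a::euclidean_space. 1)"
proof -
  have *: "gauss_weight c l x = exp ((norm l)\<^sup>2 / (4 * c)) * gauss_weight c 0 (- (l /\<^sub>R (2 * c)) + x)" for x :: 'a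
  proof -
    have "l \<bullet> x - c * (norm x)\<^sup>2 = (norm l)\<^sup>2 / (4 * c) - c * (norm (x - l /\<^sub>R (2 * c)))\<^sup>2"
      using assms unfolding power2_norm_eq_inner
      by (simp add: algebra_simps inner_commute field_simps)
    then show ?thesis unfolding gauss_weight_def by (simp flip: exp_add)
  qed
  have "gauss_integral c l (\<lambda>_. 1) =
    of_real (exp ((norm l)\<^sup>2 / (4 * c))) * (LINT x|lborel. complex_of_real (gauss_weight c 0 (- (l /\<^sub>R (2 * c)) + x)))"
    unfolding gauss_integral_def by (subst *) simp
  also have "(LINT x|lborel. complex_of_real (gauss_weight c 0 (- (l /\<^sub>R (2 * c)) + x))) = gauss_integral c 0 (\<lambda>_::'a. 1)"
    unfolding gauss_integral_def
    by (subst integral_lborel_translate) (auto intro!: borel_measurable_continuous_onI continuous_intros)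
  finally show ?thesis .
qed

section \<open>Derivatives in complex coordinates\<close>

lemma bounded_linear_cnj_nth: "bounded_linear (\<lambda>T :: complex ^ 'i. cnj (T $ I))"
  by (rule bounded_linear_compose[OF bounded_linear_cnj bounded_linear_vec_nth])

lemma poly_growth_nth: "poly_growth (\<lambda>T :: complex ^ 'i. T $ I)"
  by (intro poly_growth_bounded_linear bounded_linear_vec_nth)

lemma poly_growth_cnj_nth: "poly_growth (\<lambda>T :: complex ^ 'i. cnj (T $ I))"
  by (intro poly_growth_bounded_linear bounded_linear_cnj_nth)

lemma tdot_vec_cnj: "tdot T (vec_cnj T) = of_real ((norm T)\<^sup>2)"
  unfolding power2_norm_eq_inner inner_vec_def of_real_sum tdot_def vec_cnj_def
  by (intro sum.cong refl) (simp add: complex_eq_iff inner_complex_def power2_eq_square)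

text \<open>A real differential in complex coordinates: \<open>a\<close> lists the partial
  derivatives in \<open>T $ I\<close>, \<open>b\<close> those in \<open>cnj (T $ I)\<close>.\<close>

definition wirtinger_form :: "complex ^ 'i \<Rightarrow> complex ^ 'i \<Rightarrow> complex ^ 'i \<Rightarrow> complex" where
  "wirtinger_form a b h = (\<Sum>I\<in>UNIV. a $ I * h $ I + b $ I * cnj (h $ I))"

lemma wirtinger_form_axis: "wirtinger_form a b (axis I z) = a $ I * z + b $ I * cnj z"
proof -
  have "wirtinger_form a b (axis I z) = (\<Sum>I'\<in>UNIV. if I' = I then a $ I * z + b $ I * cnj z else 0)"
    unfolding wirtinger_form_def by (intro sum.cong) (auto simp: axis_def)
  then show ?thesis by simp
qed

text \<open>The Schwinger-Dyson equations. The linear term \<open>-2 *\<^sub>R J\<close> makes the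
  derivative of the exponent in \<open>cnj (T $ I)\<close> equal to
  \<open>- (c * T $ I + J $ I)\<close>, and the one in \<open>T $ I\<close> is its
  conjugate.\<close>

lemma gauss_integral_wirtinger:
  fixes F :: "complex ^ 'i \<Rightarrow> complex"
  assumes c: "c > 0" and F: "poly_growth F"
    and ab: "\<And>I. poly_growth (\<lambda>T. a T $ I)" "\<And>I. poly_growth (\<lambda>T. b T $ I)"
    and deriv: "\<And>T. (F has_derivative wirtinger_form (a T) (b T)) (at T)"
  shows "gauss_integral c (-2 *\<^sub>R J) (\<lambda>T. b T $ I) = gauss_integral c (-2 *\<^sub>R J) (\<lambda>T. (c * T $ I + J $ I) * F T)"
    and "gauss_integral c (-2 *\<^sub>R J) (\<lambda>T. a T $ I) = gauss_integral c (-2 *\<^sub>R J) (\<lambda>T. (c * cnj (T $ I) + cnj (J $ I)) * F T)"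
proof -
  have pg: "poly_growth (\<lambda>x. wirtinger_form (a x) (b x) (axis I z))" for z
    unfolding wirtinger_form_axis by (intro poly_growth_add poly_growth_mult ab poly_growth_const)
  have inner: "complex_of_real (x \<bullet> axis I 1) + \<i> * complex_of_real (x \<bullet> axis I \<i>) = x $ I"
     "complex_of_real (x \<bullet> axis I 1) + (-\<i>) * complex_of_real (x \<bullet> axis I \<i>) = cnj (x $ I)" for x :: "complex ^ 'i"
    by (auto simp: inner_axis complex_eq_iff)
  \<comment> \<open>The factor \<open>2\<close> here matches the one on the right that comes from
    \<open>2 * c\<close> and from \<open>-2 *\<^sub>R J\<close>, so both cancel.\<close>
  have form: "wirtinger_form a b (axis I 1) + \<i> * wirtinger_form a b (axis I \<i>) = 2 * b $ I"
    "wirtinger_form a b (axis I 1) + (-\<i>) * wirtinger_form a b (axis I \<i>) = 2 * a $ I" for a b :: "complex ^ 'i"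
    unfolding wirtinger_form_axis by (auto simp: algebra_simps)
  note ibp = gauss_integral_by_parts_complex[where F="F" and F'="\<lambda>T. wirtinger_form (a T) (b T)" and u="axis I 1" and v="axis I \<i>" and l="-2 *\<^sub>R J", OF c F pg pg deriv]
  have "gauss_integral c (-2 *\<^sub>R J) (\<lambda>T. 2 * b T $ I) = gauss_integral c (-2 *\<^sub>R J) (\<lambda>T. 2 * ((c * T $ I + J $ I) * F T))"
    using ibp[of \<i>] unfolding form inner by (simp add: algebra_simps scaleR_conv_of_real)
  then show "gauss_integral c (-2 *\<^sub>R J) (\<lambda>T. b T $ I) = gauss_integral c (-2 *\<^sub>R J) (\<lambda>T. (c * T $ I + J $ I) * F T)"
    unfolding gauss_integral_mult_left by simp
  have "gauss_integral c (-2 *\<^sub>R J) (\<lambda>T. 2 * a T $ I) = gauss_integral c (-2 *\<^sub>R J) (\<lambda>T. 2 * ((c * cnj (T $ I) + cnj (J $ I)) * F T))"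
    using ibp[of "-\<i>"] unfolding form inner by (simp add: algebra_simps scaleR_conv_of_real)
  then show "gauss_integral c (-2 *\<^sub>R J) (\<lambda>T. a T $ I) = gauss_integral c (-2 *\<^sub>R J) (\<lambda>T. (c * cnj (T $ I) + cnj (J $ I)) * F T)"
    unfolding gauss_integral_mult_left by simp
qed

section \<open>The exponential of the logarithm and the resolvent as a moment series\<close>

lemma fps_const_sum: "fps_const (\<Sum>i\<in>S. f i) = (\<Sum>i\<in>S. fps_const (f i))"
  by (induction S rule: infinite_finite_induct) (auto simp flip: fps_const_add)

text \<open>Multiplication by \<open>fps_X\<close> raises the order, so coefficient
  \<open>m + 1\<close> at index \<open>j\<close> depends only on \<open>u j\<close> and on
  coefficient \<open>m\<close> at index \<open>j + 1\<close>. The recurrence therefore determines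
  the whole family, by induction on the coefficient with \<open>j\<close> arbitrary.\<close>

lemma fps_eq_if_shift_recurrence:
  fixes a b :: "nat \<Rightarrow> 'a::comm_ring_1 fps"
  assumes "\<And>j. a j + fps_X * a (Suc j) = u j" "\<And>j. b j + fps_X * b (Suc j) = u j"
  shows "a j = b j"
proof -
  have "fps_nth (a j) m = fps_nth (b j) m" for j m
  proof (induction m arbitrary: j)
    case 0
    from assms[of j] have "fps_nth (a j + fps_X * a (Suc j)) 0 = fps_nth (b j + fps_X * b (Suc j)) 0" by simp
    then show ?case by simp
  next
    case (Suc m)
    from assms[of j] have "fps_nth (a j + fps_X * a (Suc j)) (Suc m) = fps_nth (b j + fps_X * b (Suc j)) (Suc m)" by simp
    then show ?case using Suc by simp
  qed
  then show ?thesis by (simp add: fps_eq_iff)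
qed

lemma fps_linear_ode_unique:
  fixes F G :: "complex fps"
  assumes "fps_deriv F = g * F" "fps_deriv G = g * G" "fps_nth F 0 = fps_nth G 0"
  shows "F = G"
proof (rule fps_ext)
  fix m
  show "fps_nth F m = fps_nth G m"
  proof (induction m rule: less_induct)
    case (less m)
    show ?case
    proof (cases m)
      case (Suc k)
      have *: "of_nat (Suc k) * fps_nth H (Suc k) = (\<Sum>i\<le>k. fps_nth g i * fps_nth H (k - i))"
        if "fps_deriv H = g * H" for H :: "complex fps"
      proof -
        have "fps_nth (fps_deriv H) k = fps_nth (g * H) k" using that by simp
        then show ?thesis by (simp add: fps_mult_nth atLeast0AtMost)
      qed
      have "of_nat (Suc k) * fps_nth F (Suc k) = of_nat (Suc k) * fps_nth G (Suc k)"
        unfolding *[OF assms(1)] *[OF assms(2)] using less Suc by (intro sum.cong) auto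
      then show ?thesis using Suc by (simp del: of_nat_Suc)
    qed (use assms in simp)
  qed
qed

lemma formal_exp_nth_0: "fps_nth (formal_exp f) 0 = exp (fps_nth f 0)"
  by (simp add: formal_exp_def)

lemma fps_deriv_formal_exp: "fps_deriv (formal_exp f) = fps_deriv f * formal_exp f"
proof -
  let ?g = "f - fps_const (fps_nth f 0)"
  have "fps_nth ?g 0 = 0" by simp
  from fps_compose_deriv[OF this, of "fps_exp 1"]
  show ?thesis unfolding formal_exp_def by (simp add: algebra_simps)
qed

section \<open>Moments of the quadratic form and their recurrences\<close>

abbreviation mpow :: "complex ^ 'i ^ 'i \<Rightarrow> nat \<Rightarrow> complex ^ 'i ^ 'i" where
  "mpow A j \<equiv> ((**) A ^^ j) (mat 1)"

lemma mpow_commute: "mpow A j ** A = A ** mpow A j"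
  by (induction j) (auto simp: matrix_mul_assoc[symmetric])

definition quad_form :: "complex ^ 'i ^ 'i \<Rightarrow> complex ^ 'i \<Rightarrow> complex" where
  "quad_form A T = (\<Sum>K\<in>UNIV. \<Sum>I\<in>UNIV. A $ K $ I * (T $ K * cnj (T $ I)))"

text \<open>This and \<open>quad_dcnj\<close> are the gradients of \<open>quad_form A\<close> in
  \<open>T\<close> and in \<open>cnj T\<close>, treated as independent variables.\<close>

definition quad_dT :: "complex ^ 'i ^ 'i \<Rightarrow> complex ^ 'i \<Rightarrow> complex ^ 'i" where
  "quad_dT A T = (\<chi> K. \<Sum>I\<in>UNIV. A $ K $ I * cnj (T $ I))"

definition quad_dcnj :: "complex ^ 'i ^ 'i \<Rightarrow> complex ^ 'i \<Rightarrow> complex ^ 'i" where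
  "quad_dcnj A T = (\<chi> I. \<Sum>K\<in>UNIV. A $ K $ I * T $ K)"

lemma poly_growth_quad:
  "poly_growth (quad_form A)" "poly_growth (\<lambda>T. quad_dT A T $ I)" "poly_growth (\<lambda>T. quad_dcnj A T $ I)"
  unfolding quad_form_def quad_dT_def quad_dcnj_def 
  by (auto intro!: poly_growth_intros poly_growth_nth poly_growth_cnj_nth)

lemma has_derivative_quad_form:
  "(quad_form A has_derivative wirtinger_form (quad_dT A T) (quad_dcnj A T)) (at T)"
proof -
  have "((\<lambda>T. quad_form A T) has_derivative
     (\<lambda>h. \<Sum>K\<in>UNIV. \<Sum>I\<in>UNIV. A $ K $ I * (T $ K * cnj (h $ I) + h $ K * cnj (T $ I)))) (at T)"
    unfolding quad_form_def
    by (intro has_derivative_sum has_derivative_mult_right has_derivative_mult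
        bounded_linear_imp_has_derivative bounded_linear_vec_nth bounded_linear_cnj_nth)
  moreover have "(\<Sum>K\<in>UNIV. \<Sum>I\<in>UNIV. A $ K $ I * (T $ K * cnj (h $ I) + h $ K * cnj (T $ I))) =
      wirtinger_form (quad_dT A T) (quad_dcnj A T) h" for h
  proof -
    have "(\<Sum>K\<in>UNIV. \<Sum>I\<in>UNIV. A $ K $ I * (T $ K * cnj (h $ I))) = (\<Sum>I\<in>UNIV. \<Sum>K\<in>UNIV. A $ K $ I * (T $ K * cnj (h $ I)))"
      by (rule sum.swap)
    then show ?thesis
      unfolding wirtinger_form_def quad_dT_def quad_dcnj_def
      by (simp add: distrib_left sum.distrib sum_distrib_left sum_distrib_right mult_ac)
  qed
  ultimately show ?thesis by simp
qed

text \<open>The unnormalised expectation of \<open>F T * exp (- c * t * quad_form A T)\<close> with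
  source \<open>J\<close>, as a formal series in \<open>t\<close>. The exponential is expanded
  before integrating, since for a given \<open>t\<close> the integral may diverge.\<close>

definition moment_series :: "real \<Rightarrow> complex ^ 'i \<Rightarrow> complex ^ 'i ^ 'i \<Rightarrow> (complex ^ 'i \<Rightarrow> complex) \<Rightarrow> complex fps" where
  "moment_series c J A F = Abs_fps (\<lambda>m. (- of_real c) ^ m / fact m * gauss_integral c (-2 *\<^sub>R J) (\<lambda>T. F T * quad_form A T ^ m))"

lemma moment_series_mult_left: "moment_series c J A (\<lambda>T. a * F T) = fps_const a * moment_series c J A F"
  by (rule fps_ext) (simp add: moment_series_def gauss_integral_mult_left mult.assoc)

lemma moment_series_sum:
  assumes "c > 0" "\<And>i. i \<in> S \<Longrightarrow> poly_growth (F i)"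
  shows "moment_series c J A (\<lambda>T. \<Sum>i\<in>S. F i T) = (\<Sum>i\<in>S. moment_series c J A (F i))"
proof (rule fps_ext)
  fix m
  have "gauss_integral c (-2 *\<^sub>R J) (\<lambda>T. (\<Sum>i\<in>S. F i T) * quad_form A T ^ m) =
    (\<Sum>i\<in>S. gauss_integral c (-2 *\<^sub>R J) (\<lambda>T. F i T * quad_form A T ^ m))"
    unfolding sum_distrib_right
    by (intro gauss_integral_sum poly_growth_mult poly_growth_power poly_growth_quad assms)
  then show "fps_nth (moment_series c J A (\<lambda>T. \<Sum>i\<in>S. F i T)) m = fps_nth (\<Sum>i\<in>S. moment_series c J A (F i)) m"
    by (simp add: moment_series_def fps_sum_nth sum_distrib_left sum_divide_distrib)
qed

text \<open>Integration by parts for \<open>F T * quad_form A T ^ m\<close>. Differentiating the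
  power gives \<open>m\<close> times the power \<open>m - 1\<close>; under the weights
  \<open>(- c) ^ m / fact m\<close> this becomes multiplication of the series by
  \<open>- c * fps_X\<close>.\<close>

lemma moment_series_wirtinger:
  fixes F :: "complex ^ 'i \<Rightarrow> complex"
  assumes c: "c > 0" and F: "poly_growth F"
    and ab: "\<And>I. poly_growth (\<lambda>T. a T $ I)" "\<And>I. poly_growth (\<lambda>T. b T $ I)"
    and deriv: "\<And>T. (F has_derivative wirtinger_form (a T) (b T)) (at T)"
  shows "moment_series c J A (\<lambda>T. b T $ I) - fps_const (of_real c) * fps_X * moment_series c J A (\<lambda>T. F T * quad_dcnj A T $ I)
      = fps_const (of_real c) * moment_series c J A (\<lambda>T. T $ I * F T) + fps_const (J $ I) * moment_series c J A F"
    and "moment_series c J A (\<lambda>T. a T $ I) - fps_const (of_real c) * fps_X * moment_series c J A (\<lambda>T. F T * quad_dT A T $ I)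
      = fps_const (of_real c) * moment_series c J A (\<lambda>T. cnj (T $ I) * F T) + fps_const (cnj (J $ I)) * moment_series c J A F"
proof -
  let ?Q = "quad_form A"
  let ?E = "gauss_integral c (-2 *\<^sub>R J)"
  have pg: "poly_growth (\<lambda>T. F T * ?Q T ^ m)" for m
    by (intro poly_growth_intros F poly_growth_quad)
  \<comment> \<open>\<open>aa\<close> and \<open>bb\<close> are the gradients of
    \<open>F T * quad_form A T ^ m\<close> in \<open>T\<close> and in \<open>cnj T\<close>, by the
    product rule.\<close>
  define aa where "aa m T = (\<chi> I. a T $ I * ?Q T ^ m + of_nat m * (F T * quad_dT A T $ I * ?Q T ^ (m - 1)))" for m T
  define bb where "bb m T = (\<chi> I. b T $ I * ?Q T ^ m + of_nat m * (F T * quad_dcnj A T $ I * ?Q T ^ (m - 1)))" for m T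
  have pgab: "poly_growth (\<lambda>T. aa m T $ I)" "poly_growth (\<lambda>T. bb m T $ I)" for m I
    unfolding aa_def bb_def using F ab by (auto intro!: poly_growth_intros poly_growth_quad)
  have d: "((\<lambda>T. F T * ?Q T ^ m) has_derivative wirtinger_form (aa m T) (bb m T)) (at T)" for m T
  proof -
    have "((\<lambda>T. F T * ?Q T ^ m) has_derivative
       (\<lambda>h. F T * (of_nat m * wirtinger_form (quad_dT A T) (quad_dcnj A T) h * ?Q T ^ (m - 1)) + wirtinger_form (a T) (b T) h * ?Q T ^ m)) (at T)"
      by (intro has_derivative_mult deriv has_derivative_power has_derivative_quad_form)
    moreover have "(\<lambda>h. F T * (of_nat m * wirtinger_form (quad_dT A T) (quad_dcnj A T) h * ?Q T ^ (m - 1)) + wirtinger_form (a T) (b T) h * ?Q T ^ m)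
       = wirtinger_form (aa m T) (bb m T)"
      unfolding wirtinger_form_def aa_def bb_def
      by (simp add: fun_eq_iff sum_distrib_left sum_distrib_right sum.distrib[symmetric] algebra_simps)
    ultimately show ?thesis by simp
  qed
  note w = gauss_integral_wirtinger[OF c pg pgab d, where J=J and I=I]
  have fct: "(- of_real c) ^ Suc m / fact (Suc m) * (of_nat (Suc m) * z) = - of_real c * ((- of_real c) ^ m / fact m * z)" for m and z :: complex
    by (simp add: field_simps del: of_nat_Suc) 
  have pgx: "poly_growth (\<lambda>T. x T $ I * ?Q T ^ m)" "poly_growth (\<lambda>T. F T * x T $ I * ?Q T ^ m)"
    if "\<And>I. poly_growth (\<lambda>T. x T $ I)" for x m
    using that F by (auto intro!: poly_growth_intros poly_growth_quad)
  have split: "?E (\<lambda>T. x T $ I * ?Q T ^ m + of_nat m * (F T * y T $ I * ?Q T ^ (m - 1))) =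
      ?E (\<lambda>T. x T $ I * ?Q T ^ m) + of_nat m * ?E (\<lambda>T. F T * y T $ I * ?Q T ^ (m - 1))"
    if "\<And>I. poly_growth (\<lambda>T. x T $ I)" "\<And>I. poly_growth (\<lambda>T. y T $ I)" for x y m
    by (subst gauss_integral_add[OF c]) (auto simp: gauss_integral_mult_left intro!: poly_growth_intros poly_growth_quad F that)
  have rhs: "?E (\<lambda>T. (of_real c * z T + k) * (F T * ?Q T ^ m)) = of_real c * ?E (\<lambda>T. z T * F T * ?Q T ^ m) + k * ?E (\<lambda>T. F T * ?Q T ^ m)"
    if "poly_growth z" for z k m
  proof -
    have "?E (\<lambda>T. (of_real c * z T + k) * (F T * ?Q T ^ m)) = ?E (\<lambda>T. of_real c * (z T * F T * ?Q T ^ m) + k * (F T * ?Q T ^ m))"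
      by (simp add: algebra_simps)
    also have "\<dots> = of_real c * ?E (\<lambda>T. z T * F T * ?Q T ^ m) + k * ?E (\<lambda>T. F T * ?Q T ^ m)"
      by (subst gauss_integral_add[OF c]) (use that F in \<open>auto simp: gauss_integral_mult_left intro!: poly_growth_intros poly_growth_quad\<close>)
    finally show ?thesis .
  qed
  \<comment> \<open>Common to both claims: \<open>x\<close> is a gradient of \<open>F\<close>,
    \<open>y\<close> the same gradient of the quadratic form, and \<open>c * z + k\<close> the
    factor produced by the weight.\<close>
  have key: "moment_series c J A (\<lambda>T. x T $ I) - fps_const (of_real c) * fps_X * moment_series c J A (\<lambda>T. F T * y T $ I)
      = fps_const (of_real c) * moment_series c J A (\<lambda>T. z T * F T) + fps_const k * moment_series c J A F"
    if "\<And>I. poly_growth (\<lambda>T. x T $ I)" "\<And>I. poly_growth (\<lambda>T. y T $ I)" "poly_growth z"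
      and eq: "\<And>m. ?E (\<lambda>T. x T $ I * ?Q T ^ m + of_nat m * (F T * y T $ I * ?Q T ^ (m - 1))) = ?E (\<lambda>T. (of_real c * z T + k) * (F T * ?Q T ^ m))"
    for x y z k
  proof (rule fps_ext)
    fix m
    let ?f = "(- complex_of_real c) ^ m / fact m"
    note e = eq[of m, unfolded split[OF that(1,2)] rhs[OF that(3)]]
    \<comment> \<open>For \<open>m = 0\<close> the factor \<open>of_nat m\<close> makes the
      truncated exponent \<open>m - 1\<close> harmless.\<close>
    have lhs: "fps_nth (fps_const (of_real c) * fps_X * moment_series c J A (\<lambda>T. F T * y T $ I)) m =
      - (?f * (of_nat m * ?E (\<lambda>T. F T * y T $ I * ?Q T ^ (m - 1))))"
    proof (cases m)
      case (Suc k)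
      then show ?thesis using fct[of k] by (simp add: moment_series_def mult.assoc del: fact_Suc power_Suc of_nat_Suc)
    qed (simp add: mult.assoc)
    show "fps_nth (moment_series c J A (\<lambda>T. x T $ I) - fps_const (of_real c) * fps_X * moment_series c J A (\<lambda>T. F T * y T $ I)) m
      = fps_nth (fps_const (of_real c) * moment_series c J A (\<lambda>T. z T * F T) + fps_const k * moment_series c J A F) m"
      unfolding fps_sub_nth lhs
      using arg_cong[OF e, of "\<lambda>z. ?f * z"] by (simp add: moment_series_def algebra_simps)
  qed
  show "moment_series c J A (\<lambda>T. b T $ I) - fps_const (of_real c) * fps_X * moment_series c J A (\<lambda>T. F T * quad_dcnj A T $ I)
      = fps_const (of_real c) * moment_series c J A (\<lambda>T. T $ I * F T) + fps_const (J $ I) * moment_series c J A F"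
    using w(1) by (intro key ab poly_growth_quad poly_growth_nth) (simp add: bb_def)
  show "moment_series c J A (\<lambda>T. a T $ I) - fps_const (of_real c) * fps_X * moment_series c J A (\<lambda>T. F T * quad_dT A T $ I)
      = fps_const (of_real c) * moment_series c J A (\<lambda>T. cnj (T $ I) * F T) + fps_const (cnj (J $ I)) * moment_series c J A F"
    using w(2) by (intro key ab poly_growth_quad poly_growth_cnj_nth) (simp add: aa_def)
qed

lemma fps_deriv_moment_series:
  assumes "c > 0"
  shows "fps_deriv (moment_series c J A (\<lambda>_. 1)) = - fps_const (of_real c) *
    (\<Sum>K\<in>UNIV. \<Sum>I\<in>UNIV. fps_const (A $ K $ I) * moment_series c J A (\<lambda>T. T $ K * cnj (T $ I)))"
proof -
  have "fps_deriv (moment_series c J A (\<lambda>_. 1)) = - fps_const (of_real c) * moment_series c J A (quad_form A)"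
    by (rule fps_ext) (simp add: moment_series_def field_simps del: of_nat_Suc)
  also have "moment_series c J A (quad_form A) = (\<Sum>K\<in>UNIV. \<Sum>I\<in>UNIV. fps_const (A $ K $ I) * moment_series c J A (\<lambda>T. T $ K * cnj (T $ I)))"
    unfolding quad_form_def[abs_def]
    by (simp add: moment_series_sum moment_series_mult_left assms poly_growth_intros poly_growth_nth poly_growth_cnj_nth)
  finally show ?thesis .
qed

text \<open>Integration by parts in \<open>T $ K\<close> of the constant \<open>1\<close>. With
  \<open>C\<close> the vector of the series of \<open>cnj T\<close> and \<open>H\<close> the series
  of \<open>1\<close>, it is the linear system
  \<open>c * (1 + t * A) C = - H * cnj J\<close>.\<close>

lemma moment_series_cnj_recurrence:
  assumes c: "c > 0"
  shows "fps_const (of_real c) * (moment_series c J A (\<lambda>T. cnj (T $ K)) +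
      fps_X * (\<Sum>L\<in>UNIV. fps_const (A $ K $ L) * moment_series c J A (\<lambda>T. cnj (T $ L)))) =
    - fps_const (cnj (J $ K)) * moment_series c J A (\<lambda>_. 1)"
proof -
  have "((\<lambda>_. 1) has_derivative wirtinger_form 0 0) (at T)" for T :: "complex ^ 'a"
    by (auto intro!: derivative_eq_intros simp: wirtinger_form_def)
  note w = moment_series_wirtinger(2)[OF c poly_growth_const _ _ this, where J=J and A=A and I=K]
  have 0: "moment_series c J A (\<lambda>_. 0) = 0"
    using moment_series_mult_left[of c J A 0 "\<lambda>_. 1"] by simp
  have "moment_series c J A (\<lambda>T. quad_dT A T $ K) = (\<Sum>L\<in>UNIV. fps_const (A $ K $ L) * moment_series c J A (\<lambda>T. cnj (T $ L)))"
    unfolding quad_dT_def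
    by (simp add: moment_series_sum moment_series_mult_left c poly_growth_intros poly_growth_cnj_nth)
  with w 0 have "- (fps_const (of_real c) * fps_X * (\<Sum>L\<in>UNIV. fps_const (A $ K $ L) * moment_series c J A (\<lambda>T. cnj (T $ L)))) =
      fps_const (of_real c) * moment_series c J A (\<lambda>T. cnj (T $ K)) + fps_const (cnj (J $ K)) * moment_series c J A (\<lambda>_. 1)"
    by (simp add: poly_growth_const)
  then show ?thesis by (simp add: algebra_simps neg_eq_iff_add_eq_0 eq_neg_iff_add_eq_0 flip: fps_const_neg)
qed

text \<open>Integration by parts in \<open>cnj (T $ I)\<close> of \<open>cnj (T $ K)\<close>, whose
  derivative is the Kronecker delta. It is a linear system for the second moments, with the first
  moments on the right.\<close>

lemma moment_series_nth_cnj_recurrence: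
  assumes c: "c > 0"
  shows "fps_const (of_real c) * (moment_series c J A (\<lambda>T. T $ I * cnj (T $ K)) +
      fps_X * (\<Sum>L\<in>UNIV. fps_const (A $ L $ I) * moment_series c J A (\<lambda>T. T $ L * cnj (T $ K)))) =
    (if I = K then moment_series c J A (\<lambda>_. 1) else 0) - fps_const (J $ I) * moment_series c J A (\<lambda>T. cnj (T $ K))"
proof -
  have d: "((\<lambda>T. cnj (T $ K)) has_derivative wirtinger_form 0 (axis K 1)) (at T)" for T :: "complex ^ 'a"
  proof -
    have "wirtinger_form 0 (axis K 1) h = cnj (h $ K)" for h :: "complex ^ 'a"
    proof -
      have "wirtinger_form 0 (axis K 1) h = (\<Sum>I\<in>UNIV. if I = K then cnj (h $ K) else 0)"
        unfolding wirtinger_form_def by (intro sum.cong) (auto simp: axis_def)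
      then show ?thesis by simp
    qed
    then have "wirtinger_form 0 (axis K 1) = (\<lambda>h :: complex ^ 'a. cnj (h $ K))" by (simp add: fun_eq_iff)
    then show ?thesis
      by (simp add: bounded_linear_imp_has_derivative bounded_linear_cnj_nth)
  qed
  note w = moment_series_wirtinger(1)[OF c poly_growth_cnj_nth poly_growth_const poly_growth_const d, where J=J and A=A and I=I]
  have 0: "moment_series c J A (\<lambda>_. 0) = 0"
    using moment_series_mult_left[of c J A 0 "\<lambda>_. 1"] by simp
  have "moment_series c J A (\<lambda>_. axis K 1 $ I) = (if I = K then moment_series c J A (\<lambda>_. 1) else 0)"
    using 0 by (auto simp: axis_def)
  moreover have "moment_series c J A (\<lambda>T. cnj (T $ K) * quad_dcnj A T $ I) = (\<Sum>L\<in>UNIV. fps_const (A $ L $ I) * moment_series c J A (\<lambda>T. T $ L * cnj (T $ K)))"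
  proof -
    have "(\<lambda>T. cnj (T $ K) * quad_dcnj A T $ I) = (\<lambda>T. \<Sum>L\<in>UNIV. A $ L $ I * (T $ L * cnj (T $ K)))"
      unfolding quad_dcnj_def by (simp add: sum_distrib_left mult_ac)
    then show ?thesis
      by (simp add: moment_series_sum moment_series_mult_left c poly_growth_intros poly_growth_nth poly_growth_cnj_nth)
  qed
  ultimately show ?thesis using w by (simp add: algebra_simps)
qed

text \<open>The signed tails of a sequence, with weights \<open>1\<close> and \<open>i + 1\<close>, are the coefficients of
  \<open>A ^ j (1 + t A) ^ -1\<close> and \<open>A ^ j (1 + t A) ^ -2\<close> traced against a fixed matrix.\<close>

definition alt_tail :: "(nat \<Rightarrow> complex) \<Rightarrow> nat \<Rightarrow> complex fps" where
  "alt_tail u j = Abs_fps (\<lambda>i. (-1) ^ i * u (i + j))"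

definition alt_tail2 :: "(nat \<Rightarrow> complex) \<Rightarrow> nat \<Rightarrow> complex fps" where
  "alt_tail2 u j = Abs_fps (\<lambda>i. (-1) ^ i * of_nat (i + 1) * u (i + j))"

lemma alt_tail_recurrence: "alt_tail u j + fps_X * alt_tail u (Suc j) = fps_const (u j)"
proof (rule fps_ext)
  show "fps_nth (alt_tail u j + fps_X * alt_tail u (Suc j)) m = fps_nth (fps_const (u j)) m" for m
    by (cases m) (auto simp: alt_tail_def)
qed

lemma alt_tail2_recurrence: "alt_tail2 u j + fps_X * alt_tail2 u (Suc j) = alt_tail u j"
proof (rule fps_ext)
  show "fps_nth (alt_tail2 u j + fps_X * alt_tail2 u (Suc j)) m = fps_nth (alt_tail u j) m" for m
    by (cases m) (auto simp: alt_tail_def alt_tail2_def algebra_simps)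
qed

text \<open>The derivatives of \<open>ln (1 + t * A)\<close> and \<open>(1 + t * A) ^ -1\<close> in
  \<open>t\<close> are \<open>A (1 + t * A) ^ -1\<close> and \<open>- A (1 + t * A) ^ -2\<close>,
  which is why both tails start at index \<open>1\<close>.\<close>

lemma fps_deriv_exponent:
  "fps_deriv (- tr_ln_one_plus A + fps_const k * tr_resolvent S A) =
    - alt_tail (\<lambda>j. trace (mpow A j)) 1 - fps_const k * alt_tail2 (\<lambda>j. trace (S ** mpow A j)) 1"
proof (rule fps_ext)
  fix m
  have "complex_of_nat (Suc m) \<noteq> 0" by (simp del: of_nat_Suc)
  moreover have "inverse (1 + fps_X :: complex fps) = Abs_fps (\<lambda>n. (- 1) ^ n)"
    by (rule fps_inverse_fps_X_plus1)
  ultimately show "fps_nth (fps_deriv (- tr_ln_one_plus A + fps_const k * tr_resolvent S A)) m =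
    fps_nth (- alt_tail (\<lambda>j. trace (mpow A j)) 1 - fps_const k * alt_tail2 (\<lambda>j. trace (S ** mpow A j)) 1) m"
    by (simp add: tr_ln_one_plus_def tr_resolvent_def trace_series_def fps_ln_def
        alt_tail_def alt_tail2_def field_simps del: of_nat_Suc)
qed

text \<open>The linear systems for the first and second moments are solved without inverting
  \<open>1 + t * A\<close>: contracted with powers of \<open>A\<close> they become recurrences in
  the exponent, which the signed tails also satisfy.\<close>

lemma moment_series_eq_formal_exp:
  fixes J :: "complex ^ 'i"
  assumes c: "c > 0"
  shows "moment_series c J A (\<lambda>_. 1) = fps_const (gauss_integral c 0 (\<lambda>_::complex ^ 'i. 1)) *
    formal_exp (- tr_ln_one_plus A + fps_const (1 / of_real c) * tr_resolvent (source_matrix J) A)"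
proof (rule fps_linear_ode_unique)
  let ?H = "moment_series c J A (\<lambda>_. 1)"
  let ?f = "- tr_ln_one_plus A + fps_const (1 / of_real c) * tr_resolvent (source_matrix J) A"
  let ?c = "fps_const (complex_of_real c)"
  let ?ci = "fps_const (1 / complex_of_real c)"
  let ?C = "\<lambda>K. moment_series c J A (\<lambda>T. cnj (T $ K))"
  let ?B = "\<lambda>I K. moment_series c J A (\<lambda>T. T $ I * cnj (T $ K))"
  define \<sigma> where "\<sigma> j = trace (source_matrix J ** mpow A j)" for j
  define \<tau> where "\<tau> j = trace (mpow A j)" for j
  \<comment> \<open>\<open>d\<close> contracts the first moments with \<open>J\<close> and the power
    \<open>j\<close> of \<open>A\<close>, \<open>b\<close> the second moments with that power; the
    factor \<open>A\<close> in the linear systems replaces \<open>j\<close> by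
    \<open>j + 1\<close>.\<close>
  define d where "d j = (\<Sum>I\<in>UNIV. \<Sum>K\<in>UNIV. fps_const (J $ I * mpow A j $ I $ K) * ?C K)" for j
  define b where "b j = (\<Sum>I\<in>UNIV. \<Sum>K\<in>UNIV. fps_const (mpow A j $ I $ K) * ?B I K)" for j
  have cci: "?c * ?ci = 1" using c by simp
  have \<sigma>: "\<sigma> j = (\<Sum>I\<in>UNIV. \<Sum>K\<in>UNIV. J $ I * mpow A j $ I $ K * cnj (J $ K))" for j
  proof -
    have "\<sigma> j = (\<Sum>K\<in>UNIV. \<Sum>I\<in>UNIV. cnj (J $ K) * J $ I * mpow A j $ I $ K)"
      by (simp add: \<sigma>_def trace_def matrix_matrix_mult_def source_matrix_def)
    then show ?thesis by (subst sum.swap) (simp add: mult_ac)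
  qed
  have d_rec: "?c * (d j + fps_X * d (Suc j)) = - fps_const (\<sigma> j) * ?H" for j
  proof -
    \<comment> \<open>The new factor \<open>A\<close> has to stand on the right, next to the first
      moments, while \<open>mpow\<close> puts it on the left.\<close>
    have "d (Suc j) = (\<Sum>I\<in>UNIV. \<Sum>L\<in>UNIV. fps_const (J $ I * (mpow A j ** A) $ I $ L) * ?C L)"
      by (simp add: d_def mpow_commute)
    also have "\<dots> = (\<Sum>I\<in>UNIV. \<Sum>L\<in>UNIV. \<Sum>K\<in>UNIV. fps_const (J $ I * mpow A j $ I $ K) * (fps_const (A $ K $ L) * ?C L))"
      by (simp add: matrix_matrix_mult_def sum_distrib_left sum_distrib_right fps_const_sum
          mult.assoc flip: fps_const_mult)
    also have "\<dots> = (\<Sum>I\<in>UNIV. \<Sum>K\<in>UNIV. fps_const (J $ I * mpow A j $ I $ K) * (\<Sum>L\<in>UNIV. fps_const (A $ K $ L) * ?C L))"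
      unfolding sum_distrib_left by (intro sum.cong refl sum.swap)
    finally have "?c * (d j + fps_X * d (Suc j)) = (\<Sum>I\<in>UNIV. \<Sum>K\<in>UNIV. fps_const (J $ I * mpow A j $ I $ K) *
         (?c * (?C K + fps_X * (\<Sum>L\<in>UNIV. fps_const (A $ K $ L) * ?C L))))"
      unfolding d_def by (simp only: sum_distrib_left distrib_left sum.distrib mult_ac)
    also have "\<dots> = - fps_const (\<sigma> j) * ?H"
      unfolding moment_series_cnj_recurrence[OF c] \<sigma>
      by (simp add: fps_const_sum sum_distrib_left sum_distrib_right sum_negf mult_ac
          flip: fps_const_mult fps_const_neg)
    finally show ?thesis .
  qed
  have b_rec: "?c * (b j + fps_X * b (Suc j)) = fps_const (\<tau> j) * ?H - d j" for j
  proof -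
    have "b (Suc j) = (\<Sum>L\<in>UNIV. \<Sum>K\<in>UNIV. \<Sum>I\<in>UNIV. fps_const (mpow A j $ I $ K) * (fps_const (A $ L $ I) * ?B L K))"
      by (simp add: b_def matrix_matrix_mult_def sum_distrib_left sum_distrib_right fps_const_sum
          mult_ac flip: fps_const_mult)
    also have "\<dots> = (\<Sum>K\<in>UNIV. \<Sum>L\<in>UNIV. \<Sum>I\<in>UNIV. fps_const (mpow A j $ I $ K) * (fps_const (A $ L $ I) * ?B L K))"
      by (rule sum.swap)
    also have "\<dots> = (\<Sum>K\<in>UNIV. \<Sum>I\<in>UNIV. \<Sum>L\<in>UNIV. fps_const (mpow A j $ I $ K) * (fps_const (A $ L $ I) * ?B L K))"
      by (intro sum.cong refl sum.swap)
    also have "\<dots> = (\<Sum>I\<in>UNIV. \<Sum>K\<in>UNIV. fps_const (mpow A j $ I $ K) * (\<Sum>L\<in>UNIV. fps_const (A $ L $ I) * ?B L K))"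
      unfolding sum_distrib_left by (rule sum.swap)
    finally have "?c * (b j + fps_X * b (Suc j)) = (\<Sum>I\<in>UNIV. \<Sum>K\<in>UNIV. fps_const (mpow A j $ I $ K) *
         (?c * (?B I K + fps_X * (\<Sum>L\<in>UNIV. fps_const (A $ L $ I) * ?B L K))))"
      unfolding b_def by (simp only: sum_distrib_left distrib_left sum.distrib mult_ac)
    also have "\<dots> = (\<Sum>I\<in>UNIV. \<Sum>K\<in>UNIV. (if I = K then fps_const (mpow A j $ I $ K) * ?H else 0)) - d j"
      unfolding moment_series_nth_cnj_recurrence[OF c] d_def sum_subtractf[symmetric]
      by (intro sum.cong refl) (auto simp: algebra_simps simp flip: fps_const_mult)
    also have "(\<Sum>I\<in>UNIV. \<Sum>K\<in>UNIV. (if I = K then fps_const (mpow A j $ I $ K) * ?H else 0)) = fps_const (\<tau> j) * ?H"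
      by (simp add: \<tau>_def trace_def fps_const_sum sum_distrib_right)
    finally show ?thesis .
  qed
  \<comment> \<open>The tails of \<open>\<sigma>\<close> times \<open>- ?H\<close> satisfy the
    recurrence \<open>d_rec\<close> too, and such a recurrence has only one solution.\<close>
  have d: "?c * d j = - alt_tail \<sigma> j * ?H" for j
  proof (rule fps_eq_if_shift_recurrence)
    show "?c * d j + fps_X * (?c * d (Suc j)) = - fps_const (\<sigma> j) * ?H" for j
      using d_rec[of j] by (simp add: algebra_simps)
    show "- alt_tail \<sigma> j * ?H + fps_X * (- alt_tail \<sigma> (Suc j) * ?H) = - fps_const (\<sigma> j) * ?H" for j
      unfolding alt_tail_recurrence[of \<sigma> j, symmetric] by (simp add: algebra_simps)
  qed
  have d': "d j = - ?ci * alt_tail \<sigma> j * ?H" for j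
  proof -
    have "d j = ?ci * (?c * d j)" using cci by (simp add: mult.assoc[symmetric])
    then show ?thesis unfolding d by (simp add: algebra_simps flip: fps_const_neg)
  qed
  \<comment> \<open>The right side of \<open>b_rec\<close> contains \<open>d j\<close>, itself a
    tail of \<open>\<sigma>\<close>; solving the shift a second time produces
    \<open>alt_tail2 \<sigma>\<close>, which belongs to the square of the resolvent.\<close>
  have b: "?c * b j = (alt_tail \<tau> j + ?ci * alt_tail2 \<sigma> j) * ?H" for j
  proof (rule fps_eq_if_shift_recurrence)
    show "?c * b j + fps_X * (?c * b (Suc j)) = fps_const (\<tau> j) * ?H - d j" for j
      using b_rec[of j] by (simp add: algebra_simps)
    show "(alt_tail \<tau> j + ?ci * alt_tail2 \<sigma> j) * ?H + fps_X * ((alt_tail \<tau> (Suc j) + ?ci * alt_tail2 \<sigma> (Suc j)) * ?H) =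
        fps_const (\<tau> j) * ?H - d j" for j
      unfolding alt_tail_recurrence[of \<tau> j, symmetric] d' alt_tail2_recurrence[of \<sigma> j, symmetric]
      by (simp add: algebra_simps flip: fps_const_neg)
  qed
  \<comment> \<open>Differentiating in \<open>t\<close> brings down \<open>quad_form A\<close>, and
    \<open>mpow A 1\<close> is \<open>A\<close>.\<close>
  have "fps_deriv ?H = - (?c * b 1)"
    unfolding fps_deriv_moment_series[OF c] b_def by (simp flip: fps_const_neg)
  then show "fps_deriv ?H = fps_deriv ?f * ?H"
    unfolding b fps_deriv_exponent \<sigma>_def \<tau>_def by (simp add: algebra_simps)
  let ?Z = "fps_const (gauss_integral c 0 (\<lambda>_::complex ^ 'i. 1))"
  show "fps_deriv (?Z * formal_exp ?f) = fps_deriv ?f * (?Z * formal_exp ?f)"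
    by (simp add: fps_deriv_formal_exp mult.left_commute del: fps_deriv_add fps_deriv_neg)
  \<comment> \<open>The logarithm has no constant term; the resolvent leaves the trace of
    \<open>source_matrix J\<close>, the squared norm of \<open>J\<close>. Divided by
    \<open>c\<close>, this is the exponent found by completing the square.\<close>
  have "fps_nth ?f 0 = of_real ((norm (-2 *\<^sub>R J))\<^sup>2 / (4 * c))"
  proof -
    have "fps_nth ?f 0 = 1 / of_real c * (\<Sum>I\<in>UNIV. cnj (J $ I) * J $ I)"
      by (simp add: tr_ln_one_plus_def tr_resolvent_def trace_series_def fps_ln_def fps_inverse_fps_X_plus1
        trace_def source_matrix_def)
    also have "(\<Sum>I\<in>UNIV. cnj (J $ I) * J $ I) = of_real ((norm J)\<^sup>2)"
      using tdot_vec_cnj[of J] by (simp add: tdot_def vec_cnj_def mult.commute)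
    finally show ?thesis using c by (simp add: power_mult_distrib)
  qed
  then have "fps_nth (formal_exp ?f) 0 = of_real (exp ((norm (-2 *\<^sub>R J))\<^sup>2 / (4 * c)))"
    by (simp only: formal_exp_nth_0 exp_of_real)
  then show "fps_nth ?H 0 = fps_nth (?Z * formal_exp ?f) 0"
    using gauss_integral_1_source[OF c, of "-2 *\<^sub>R J"]
    by (simp add: moment_series_def mult.commute)
qed

section \<open>Integration over the intermediate field\<close>

text \<open>The product of the two weights is dominated by one Gaussian weight on the product space,
  with the smaller parameter \<open>min c c'\<close>, so the joint integrand is absolutely
  integrable.\<close>

lemma gauss_integral_Fubini:
  fixes F :: "'a::euclidean_space \<times> 'b::euclidean_space \<Rightarrow> complex"
  assumes c: "c > 0" "c' > 0" and F: "poly_growth F"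
  shows "integrable lborel (\<lambda>x. of_real (gauss_weight c l x) * gauss_integral c' l' (\<lambda>y. F (x, y)))"
    and "gauss_integral c l (\<lambda>x. gauss_integral c' l' (\<lambda>y. F (x, y))) =
      gauss_integral c' l' (\<lambda>y. gauss_integral c l (\<lambda>x. F (x, y)))"
proof -
  define G where "G x y = complex_of_real (gauss_weight c l x) * (of_real (gauss_weight c' l' y) * F (x, y))" for x y
  have "integrable lborel (case_prod G)"
  proof (rule Bochner_Integration.integrable_bound)
    show "integrable lborel (\<lambda>p. of_real (gauss_weight (min c c') (l, l') p) * F p)"
      using c F by (intro poly_growth_gauss_weight_integrable) auto
    have cont: "continuous_on UNIV (\<lambda>x. gauss_weight a b (g x))"
      if "continuous_on UNIV g" for a and b :: "'c::real_inner" and g :: "'a \<times> 'b \<Rightarrow> 'c"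
      using that by (rule continuous_on_compose2[OF continuous_on_gauss_weight]) auto
    show "case_prod G \<in> borel_measurable lborel"
      using F unfolding G_def case_prod_unfold poly_growth_def
      by (auto intro!: borel_measurable_continuous_onI continuous_intros cont)
    have "gauss_weight c l x * gauss_weight c' l' y \<le> gauss_weight (min c c') (l, l') (x, y)" for x y
    proof -
      have "min c c' * (norm x)\<^sup>2 \<le> c * (norm x)\<^sup>2" "min c c' * (norm y)\<^sup>2 \<le> c' * (norm y)\<^sup>2"
        by (intro mult_right_mono; simp)+
      then show ?thesis unfolding gauss_weight_def
        by (simp add: exp_add[symmetric] norm_Pair algebra_simps)
    qed
    then show "AE p in lborel. norm (case_prod G p) \<le> norm (of_real (gauss_weight (min c c') (l, l') p) * F p)"
      by (intro AE_I2)
        (auto simp: G_def norm_mult abs_of_pos[OF gauss_weight_pos] mult.assoc[symmetric] intro!: mult_right_mono)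
  qed
  then have int: "integrable (lborel \<Otimes>\<^sub>M lborel) (case_prod G)" by (simp add: lborel_prod)
  have eq: "(LINT y|lborel. G x y) = of_real (gauss_weight c l x) * gauss_integral c' l' (\<lambda>y. F (x, y))"
    "(LINT x|lborel. G x y) = of_real (gauss_weight c' l' y) * gauss_integral c l (\<lambda>x. F (x, y))" for x y
    unfolding gauss_integral_def integral_mult_right_zero[symmetric] G_def by (simp_all only: mult.left_commute)
  show "integrable lborel (\<lambda>x. of_real (gauss_weight c l x) * gauss_integral c' l' (\<lambda>y. F (x, y)))"
    using lborel_pair.integrable_fst[OF int] by (simp add: eq)
  show "gauss_integral c l (\<lambda>x. gauss_integral c' l' (\<lambda>y. F (x, y))) =
      gauss_integral c' l' (\<lambda>y. gauss_integral c l (\<lambda>x. F (x, y)))"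
    using lborel_pair.Fubini_integral[OF int] unfolding eq by (simp add: gauss_integral_def)
qed

lemma has_bochner_integral_gauss_density:
  fixes f :: "'a::euclidean_space \<Rightarrow> complex"
  assumes "z > 0" and int: "integrable lborel (\<lambda>x. of_real (gauss_weight c l x) * f x)"
  shows "has_bochner_integral (density lborel (\<lambda>x. ennreal (gauss_weight c l x / z))) f
    (gauss_integral c l f / of_real z)"
proof -
  have w [measurable]: "gauss_weight c l \<in> borel_measurable borel"
    by (intro borel_measurable_continuous_onI continuous_intros)
  \<comment> \<open>Measurability of \<open>f\<close> is recovered from that of the weighted
    function by dividing by the positive weight.\<close>
  have "(\<lambda>x. inverse (complex_of_real (gauss_weight c l x)) * (of_real (gauss_weight c l x) * f x)) \<in> borel_measurable lborel"
    by (rule borel_measurable_times[OF _ borel_measurable_integrable[OF int]]) measurable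
  moreover have "inverse (complex_of_real (gauss_weight c l x)) * (of_real (gauss_weight c l x) * f x) = f x" for x
    using gauss_weight_pos[of c l x] by simp
  ultimately have f: "f \<in> borel_measurable lborel" by simp
  have "has_bochner_integral lborel (\<lambda>x. (gauss_weight c l x / z) *\<^sub>R f x) (gauss_integral c l f / of_real z)"
  proof -
    have "(\<lambda>x. (gauss_weight c l x / z) *\<^sub>R f x) = (\<lambda>x. of_real (gauss_weight c l x) * f x / of_real z)"
      by (simp add: scaleR_conv_of_real)
    then show ?thesis
      using int by (simp add: has_bochner_integral_iff gauss_integral_def)
  qed
  moreover have "gauss_weight c l x / z \<ge> 0" for x
    using assms(1) gauss_weight_pos[of c l x] by simp
  ultimately show ?thesis
    using f by (intro has_bochner_integral_density) auto
qed

text \<open>Polynomials in the entries of \<open>M\<close> without their conjugates. The rules fit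
  the induction in \<open>gauss_integral_reproducing\<close>, where one coordinate factor is removed
  at a time.\<close>

inductive homogeneous :: "nat \<Rightarrow> (complex ^ 'k ^ 'i \<Rightarrow> complex) \<Rightarrow> bool" where
  homogeneous_const: "homogeneous 0 (\<lambda>_. a)"
| homogeneous_add: "homogeneous d p \<Longrightarrow> homogeneous d q \<Longrightarrow> homogeneous d (\<lambda>M. p M + q M)"
| homogeneous_coord: "homogeneous d p \<Longrightarrow> homogeneous (Suc d) (\<lambda>M. M $ I $ K * p M)"

lemma homogeneous_mult_const: "homogeneous d p \<Longrightarrow> homogeneous d (\<lambda>M. a * p M)"
proof (induction rule: homogeneous.induct)
  case (homogeneous_coord d p I K)
  from homogeneous.homogeneous_coord[OF homogeneous_coord.IH, of I K] show ?case by (simp add: mult.left_commute)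
qed (auto simp: distrib_left intro: homogeneous.intros)

lemma homogeneous_mult: "homogeneous d p \<Longrightarrow> homogeneous e q \<Longrightarrow> homogeneous (d + e) (\<lambda>M. p M * q M)"
proof (induction rule: homogeneous.induct)
  case (homogeneous_coord d p I K)
  from homogeneous.homogeneous_coord[OF homogeneous_coord.IH[OF homogeneous_coord.prems], of I K] show ?case by (simp add: mult.assoc)
qed (auto simp: distrib_right intro: homogeneous.intros homogeneous_mult_const)

lemma homogeneous_0: "homogeneous d (\<lambda>_. 0)"
proof (induction d)
  case (Suc d)
  from homogeneous_coord[OF this] show ?case by simp
qed (rule homogeneous_const)

lemma homogeneous_sum: "(\<And>x. x \<in> S \<Longrightarrow> homogeneous d (p x)) \<Longrightarrow> homogeneous d (\<lambda>M. \<Sum>x\<in>S. p x M)"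
  by (induction S rule: infinite_finite_induct) (auto intro: homogeneous_0 homogeneous_add)

lemma homogeneous_prod_coord: "finite S \<Longrightarrow> homogeneous (card S) (\<lambda>M. \<Prod>x\<in>S. M $ f x $ g x)"
  by (induction S rule: finite_induct) (auto intro: homogeneous.intros)

lemma homogeneous_power: "homogeneous d p \<Longrightarrow> homogeneous (d * k) (\<lambda>M. p M ^ k)"
  by (induction k) (auto intro: homogeneous_const homogeneous_mult)

lemma bounded_linear_nth_nth: "bounded_linear (\<lambda>M :: complex ^ 'k ^ 'i. M $ I $ K)"
  by (rule bounded_linear_compose[OF bounded_linear_vec_nth bounded_linear_vec_nth])

lemma homogeneous_poly_growth: "homogeneous d p \<Longrightarrow> poly_growth p"
  by (induction rule: homogeneous.induct)
    (auto intro!: poly_growth_intros poly_growth_bounded_linear[OF bounded_linear_nth_nth])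

text \<open>The last conjunct is the Cauchy-Riemann equation in each entry: the derivative in
  \<open>cnj (M $ I $ K)\<close> vanishes.\<close>

lemma homogeneous_holomorphic:
  assumes "homogeneous d p"
  shows "\<exists>p'. (\<forall>M. (p has_derivative p' M) (at M)) \<and> (\<forall>h. poly_growth (\<lambda>M. p' M h)) \<and>
    (\<forall>M I K. p' M (axis I (axis K \<i>)) = \<i> * p' M (axis I (axis K 1)))"
  using assms
proof (induction rule: homogeneous.induct)
  case (homogeneous_const a)
  show ?case by (intro exI[of _ "\<lambda>_ _. 0"]) (auto intro: poly_growth_const)
next
  case (homogeneous_add d p q)
  then obtain p' q' where "\<forall>M. (p has_derivative p' M) (at M)" "\<forall>h. poly_growth (\<lambda>M. p' M h)"
     "\<forall>M I K. p' M (axis I (axis K \<i>)) = \<i> * p' M (axis I (axis K 1))"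
     "\<forall>M. (q has_derivative q' M) (at M)" "\<forall>h. poly_growth (\<lambda>M. q' M h)"
     "\<forall>M I K. q' M (axis I (axis K \<i>)) = \<i> * q' M (axis I (axis K 1))"
    by auto
  then show ?case
    by (intro exI[of _ "\<lambda>M h. p' M h + q' M h"]) (auto intro!: has_derivative_add poly_growth_add simp: distrib_left)
next
  case (homogeneous_coord d p I K)
  then obtain p' where p': "\<forall>M. (p has_derivative p' M) (at M)" "\<forall>h. poly_growth (\<lambda>M. p' M h)"
     "\<forall>M I K. p' M (axis I (axis K \<i>)) = \<i> * p' M (axis I (axis K 1))" by auto
  show ?case
  proof (intro exI[of _ "\<lambda>M h. M $ I $ K * p' M h + h $ I $ K * p M"] conjI allI)
    show "((\<lambda>M. M $ I $ K * p M) has_derivative (\<lambda>h. M $ I $ K * p' M h + h $ I $ K * p M)) (at M)" for M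
      using p' by (intro has_derivative_mult bounded_linear_imp_has_derivative bounded_linear_nth_nth) auto
    show "poly_growth (\<lambda>M. M $ I $ K * p' M h + h $ I $ K * p M)" for h
      using p' homogeneous_poly_growth[OF homogeneous_coord.hyps]
      by (intro poly_growth_intros poly_growth_bounded_linear[OF bounded_linear_nth_nth]) auto
    show "M $ I $ K * p' M (axis I' (axis K' \<i>)) + axis I' (axis K' \<i>) $ I $ K * p M =
       \<i> * (M $ I $ K * p' M (axis I' (axis K' 1)) + axis I' (axis K' 1) $ I $ K * p M)" for M I' K'
      using p' by (auto simp: axis_def distrib_left)
  qed
qed

section \<open>The Gaussian pairing of polynomials with antiholomorphic powers\<close>

definition cnj_pairing :: "complex ^ 'k ^ 'i \<Rightarrow> complex ^ 'k ^ 'i \<Rightarrow> complex" where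
  "cnj_pairing X M = (\<Sum>I\<in>UNIV. \<Sum>K\<in>UNIV. X $ I $ K * cnj (M $ I $ K))"

lemma bounded_linear_cnj_nth_nth: "bounded_linear (\<lambda>M :: complex ^ 'k ^ 'i. cnj (M $ I $ K))"
  by (rule bounded_linear_compose[OF bounded_linear_cnj bounded_linear_nth_nth])

lemma bounded_linear_cnj_pairing: "bounded_linear (cnj_pairing X)"
  unfolding cnj_pairing_def
  by (intro bounded_linear_sum bounded_linear_const_mult bounded_linear_cnj_nth_nth)

lemma cnj_pairing_axis: "cnj_pairing X (axis I (axis K z)) = X $ I $ K * cnj z"
proof -
  have "(\<Sum>K'\<in>UNIV. X $ I $ K' * cnj (axis K z $ K')) = (\<Sum>K'\<in>UNIV. if K' = K then X $ I $ K * cnj z else 0)"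
    by (intro sum.cong) (auto simp: axis_def)
  then have *: "(\<Sum>K'\<in>UNIV. X $ I $ K' * cnj (axis K z $ K')) = X $ I $ K * cnj z" by simp
  have "cnj_pairing X (axis I (axis K z)) = (\<Sum>I'\<in>UNIV. if I' = I then X $ I $ K * cnj z else 0)"
    unfolding cnj_pairing_def *[symmetric] by (intro sum.cong) (auto simp: axis_def[of I])
  then show ?thesis by simp
qed

lemma has_derivative_cnj_pairing_power:
  "((\<lambda>M. cnj_pairing X M ^ m) has_derivative (\<lambda>h. of_nat m * cnj_pairing X h * cnj_pairing X M ^ (m - 1))) (at M)"
  by (intro has_derivative_power bounded_linear_imp_has_derivative bounded_linear_cnj_pairing)

lemma inner_axis_axis:
  fixes M :: "complex ^ 'k ^ 'i"
  shows "of_real (M \<bullet> axis I (axis K 1)) + \<i> * of_real (M \<bullet> axis I (axis K \<i>)) = M $ I $ K"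
    "of_real (M \<bullet> axis I (axis K 1)) + (-\<i>) * of_real (M \<bullet> axis I (axis K \<i>)) = cnj (M $ I $ K)"
  by (auto simp: inner_axis complex_eq_iff)

text \<open>The power is antiholomorphic, so its derivative in \<open>M $ I $ K\<close> vanishes;
  integration by parts with \<open>\<zeta> = - \<i>\<close> then kills every integral of a power
  times \<open>cnj (M $ I $ K)\<close>.\<close>

lemma gauss_integral_cnj_pairing_power:
  fixes X :: "complex ^ 'k ^ 'i"
  shows "gauss_integral 1 0 (\<lambda>M. cnj_pairing X M ^ m) = (if m = 0 then gauss_integral 1 0 (\<lambda>_::complex ^ 'k ^ 'i. 1) else 0)"
proof (cases m)
  case (Suc k)
  let ?U = "cnj_pairing X"
  have pg: "poly_growth (\<lambda>M. ?U M ^ k)" "poly_growth (\<lambda>M. of_nat k * ?U h * ?U M ^ (k - 1))" for h k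
    by (intro poly_growth_intros poly_growth_bounded_linear[OF bounded_linear_cnj_pairing])+
  have 0: "gauss_integral 1 0 (\<lambda>M. cnj (M $ I $ K) * ?U M ^ k) = 0" for I K
  proof -
    have "gauss_integral 1 0 (\<lambda>M. 2 * (cnj (M $ I $ K) * ?U M ^ k)) = 0"
      using gauss_integral_by_parts_complex[OF zero_less_one pg(1) pg(2) pg(2) has_derivative_cnj_pairing_power,
          where l=0 and \<zeta>="-\<i>" and u="axis I (axis K 1)" and v="axis I (axis K \<i>)"]
      unfolding inner_axis_axis cnj_pairing_axis by (simp add: gauss_integral_def algebra_simps)
    then show ?thesis unfolding gauss_integral_mult_left by simp
  qed
  have "(\<lambda>M. ?U M ^ m) = (\<lambda>M. \<Sum>I\<in>UNIV. \<Sum>K\<in>UNIV. X $ I $ K * (cnj (M $ I $ K) * ?U M ^ k))"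
    unfolding Suc power_Suc by (subst cnj_pairing_def) (simp add: sum_distrib_right mult.assoc)
  then have "gauss_integral 1 0 (\<lambda>M. ?U M ^ m) = (\<Sum>I\<in>UNIV. \<Sum>K\<in>UNIV. X $ I $ K * gauss_integral 1 0 (\<lambda>M. cnj (M $ I $ K) * ?U M ^ k))"
    by (simp add: gauss_integral_sum gauss_integral_mult_left poly_growth_intros pg
        poly_growth_bounded_linear[OF bounded_linear_cnj_nth_nth])
  then show ?thesis using 0 Suc by simp
qed simp

text \<open>The exponential of \<open>cnj_pairing X\<close> is the reproducing kernel of the Bargmann-Fock space.\<close>

lemma gauss_integral_reproducing:
  fixes p :: "complex ^ 'k ^ 'i \<Rightarrow> complex"
  assumes "homogeneous d p"
  shows "gauss_integral 1 0 (\<lambda>M. p M * cnj_pairing X M ^ m) =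
    (if m = d then fact m * p X * gauss_integral 1 0 (\<lambda>_::complex ^ 'k ^ 'i. 1) else 0)"
  using assms
proof (induction arbitrary: m rule: homogeneous.induct)
  case (homogeneous_const a)
  then show ?case by (auto simp: gauss_integral_mult_left gauss_integral_cnj_pairing_power)
next
  case (homogeneous_add d p q)
  have pg: "poly_growth (\<lambda>M. p M * cnj_pairing X M ^ m)" "poly_growth (\<lambda>M. q M * cnj_pairing X M ^ m)"
    using homogeneous_add.hyps[THEN homogeneous_poly_growth]
    by (auto intro!: poly_growth_intros poly_growth_bounded_linear[OF bounded_linear_cnj_pairing])
  show ?case
    unfolding distrib_right gauss_integral_add[OF zero_less_one pg] homogeneous_add.IH by (simp add: algebra_simps)
next
  case (homogeneous_coord d p I K)
  let ?U = "cnj_pairing X"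
  obtain p' where p': "\<And>M. (p has_derivative p' M) (at M)" "\<And>h. poly_growth (\<lambda>M. p' M h)"
     "\<And>M I K. p' M (axis I (axis K \<i>)) = \<i> * p' M (axis I (axis K 1))"
    using homogeneous_holomorphic[OF homogeneous_coord.hyps] by auto
  have p: "poly_growth p" using homogeneous_coord.hyps by (rule homogeneous_poly_growth)
  have U: "poly_growth ?U" by (rule poly_growth_bounded_linear[OF bounded_linear_cnj_pairing])
  have pg: "poly_growth (\<lambda>M. p M * ?U M ^ m)"
    "poly_growth (\<lambda>M. p M * (of_nat m * ?U h * ?U M ^ (m - 1)) + p' M h * ?U M ^ m)" for h
    by (intro poly_growth_intros p p' U)+
  have d: "((\<lambda>M. p M * ?U M ^ m) has_derivative (\<lambda>h. p M * (of_nat m * ?U h * ?U M ^ (m - 1)) + p' M h * ?U M ^ m)) (at M)" for M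
    by (intro has_derivative_mult p' has_derivative_cnj_pairing_power)
  \<comment> \<open>By parts with \<open>\<zeta> = \<i>\<close>: the derivative of \<open>p\<close>
    drops out by Cauchy-Riemann, and that of \<open>?U M ^ m\<close> trades the factor
    \<open>M $ I $ K\<close> for \<open>m * X $ I $ K\<close> and one power of
    \<open>?U\<close>.\<close>
  have "gauss_integral 1 0 (\<lambda>M. 2 * (M $ I $ K * (p M * ?U M ^ m))) = gauss_integral 1 0 (\<lambda>M. 2 * of_nat m * X $ I $ K * (p M * ?U M ^ (m - 1)))"
    using gauss_integral_by_parts_complex[OF zero_less_one pg(1) pg(2) pg(2) d,
          where l=0 and \<zeta>="\<i>" and u="axis I (axis K 1)" and v="axis I (axis K \<i>)"]
    unfolding inner_axis_axis cnj_pairing_axis p'(3) by (simp add: algebra_simps)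
  then have "gauss_integral 1 0 (\<lambda>M. M $ I $ K * p M * ?U M ^ m) = of_nat m * X $ I $ K * gauss_integral 1 0 (\<lambda>M. p M * ?U M ^ (m - 1))"
    unfolding gauss_integral_mult_left by (simp add: mult.assoc)
  then show ?case
    unfolding homogeneous_coord.IH by (cases m) auto
qed

lemma intermediate_field_average:
  fixes p :: "complex ^ 'i ^ 'i \<Rightarrow> complex"
  assumes c: "c > 0" and p: "homogeneous d p"
  shows "integrable lborel (\<lambda>M. of_real (gauss_weight 1 0 M) * (p M * fps_nth (moment_series c J (mat_cnj M) (\<lambda>_. 1)) m))"
    and "gauss_integral 1 0 (\<lambda>M. p M * fps_nth (moment_series c J (mat_cnj M) (\<lambda>_. 1)) m) =
      (if m = d then (- of_real c) ^ d * gauss_integral 1 0 (\<lambda>_::complex ^ 'i ^ 'i. 1) *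
        gauss_integral c (-2 *\<^sub>R J) (\<lambda>T. p (\<chi> K I. T $ K * cnj (T $ I))) else 0)"
proof -
  let ?f = "(- complex_of_real c) ^ m / fact m"
  define F :: "(complex ^ 'i ^ 'i) \<times> (complex ^ 'i) \<Rightarrow> complex" where
    "F = (\<lambda>x. ?f * (p (fst x) * quad_form (mat_cnj (fst x)) (snd x) ^ m))"
  have pg: "poly_growth F"
  proof -
    have "poly_growth (\<lambda>x :: (complex ^ 'i ^ 'i) \<times> (complex ^ 'i). quad_form (mat_cnj (fst x)) (snd x))"
      unfolding quad_form_def mat_cnj_def
      using poly_growth_bounded_linear[OF bounded_linear_compose[OF bounded_linear_cnj_nth_nth bounded_linear_fst]]
        poly_growth_bounded_linear[OF bounded_linear_compose[OF bounded_linear_cnj_nth bounded_linear_snd]]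
        poly_growth_bounded_linear[OF bounded_linear_compose[OF bounded_linear_vec_nth bounded_linear_snd]]
      by (auto intro!: poly_growth_intros)
    then show ?thesis unfolding F_def
      by (intro poly_growth_mult poly_growth_const poly_growth_power
          poly_growth_compose_linear[OF homogeneous_poly_growth[OF p] bounded_linear_fst])
  qed
  have F1: "p M * fps_nth (moment_series c J (mat_cnj M) (\<lambda>_. 1)) m = gauss_integral c (-2 *\<^sub>R J) (\<lambda>T. F (M, T))" for M
    unfolding moment_series_def F_def fst_conv snd_conv gauss_integral_mult_left by simp
  have F2: "gauss_integral 1 0 (\<lambda>M. F (M, T)) = (if m = d then (- of_real c) ^ d * gauss_integral 1 0 (\<lambda>_::complex ^ 'i ^ 'i. 1) * p (\<chi> K I. T $ K * cnj (T $ I)) else 0)" for T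
  proof -
    \<comment> \<open>In \<open>M\<close> this is the pairing with a rank-one matrix, so the
      reproducing property evaluates \<open>p\<close> there; its factor \<open>fact m\<close>
      cancels the one in \<open>?f\<close>.\<close>
    have "quad_form (mat_cnj M) T = cnj_pairing (\<chi> K I. T $ K * cnj (T $ I)) M" for M
      by (simp add: quad_form_def cnj_pairing_def mat_cnj_def mult_ac)
    then show ?thesis
      unfolding F_def fst_conv snd_conv gauss_integral_mult_left by (simp add: gauss_integral_reproducing[OF p])
  qed
  note fub = gauss_integral_Fubini[OF zero_less_one c pg, of 0 "-2 *\<^sub>R J"]
  show "integrable lborel (\<lambda>M. of_real (gauss_weight 1 0 M) * (p M * fps_nth (moment_series c J (mat_cnj M) (\<lambda>_. 1)) m))"
    unfolding F1 by (rule fub(1))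
  show "gauss_integral 1 0 (\<lambda>M. p M * fps_nth (moment_series c J (mat_cnj M) (\<lambda>_. 1)) m) =
      (if m = d then (- of_real c) ^ d * gauss_integral 1 0 (\<lambda>_::complex ^ 'i ^ 'i. 1) *
        gauss_integral c (-2 *\<^sub>R J) (\<lambda>T. p (\<chi> K I. T $ K * cnj (T $ I))) else 0)"
    unfolding F1 fub(2) F2 by (auto simp: gauss_integral_mult_left) (simp add: gauss_integral_def)
qed

section \<open>The intermediate field representation\<close>

lemma card_whites:
  assumes "bubble B" "pairing B \<Omega>" "card (vertices B) = 2 * n"
  shows "finite (whites B)" "card (whites B) = n"
proof -
  have fin: "finite (whites B)" "finite (blacks B)" "whites B \<inter> blacks B = {}"
    using assms(1) unfolding bubble_def vertices_def by auto
  moreover have "card (whites B) = card (blacks B)"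
    using assms(2) unfolding pairing_def by (rule bij_betw_same_card)
  ultimately show "finite (whites B)" "card (whites B) = n"
    using assms(3) card_Un_disjoint[OF fin] unfolding vertices_def by auto
qed

lemma homogeneous_matrix_bubble:
  "finite (whites B) \<Longrightarrow> homogeneous (card (whites B)) (matrix_bubble B \<Omega>)"
  unfolding matrix_bubble_def[abs_def] by (intro homogeneous_sum homogeneous_prod_coord)

text \<open>At a rank-one matrix the factor of a white vertex splits into one for it and one for its
  partner, and the pairing reindexes the latter over the black vertices.\<close>

lemma matrix_bubble_rank_one:
  assumes "pairing B \<Omega>"
  shows "matrix_bubble B \<Omega> (\<chi> K I. T $ K * cnj (T $ I)) = bubble_trace B T (vec_cnj T)"
proof -
  have "(\<Prod>b\<in>blacks B. cnj (T $ x b)) = (\<Prod>a\<in>whites B. cnj (T $ x (\<Omega> a)))" for x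
    using prod.reindex_bij_betw[of \<Omega> "whites B" "blacks B" "\<lambda>b. cnj (T $ x b)"] assms
    unfolding pairing_def by simp
  then show ?thesis
    by (simp add: matrix_bubble_def bubble_trace_def vec_cnj_def prod.distrib)
qed

lemma poly_growth_bubble_trace: "poly_growth (\<lambda>T. bubble_trace B T (vec_cnj T))"
  unfolding bubble_trace_def vec_cnj_def
  by (auto intro!: poly_growth_intros poly_growth_nth poly_growth_cnj_nth)

text \<open>The two source terms are conjugate to each other, so the exponent is real and fits into
  the linear term of \<open>gauss_weight\<close>.\<close>

lemma source_exponent: "- tdot (vec_cnj J) T - tdot (vec_cnj T) J = of_real ((-2 *\<^sub>R J) \<bullet> T)"
proof -
  have "- (cnj z * w) - cnj w * z = of_real (-2 * (z \<bullet> w))" for z w :: complex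
    by (simp add: complex_eq_iff inner_complex_def)
  then have "- tdot (vec_cnj J) T - tdot (vec_cnj T) J = (\<Sum>I\<in>UNIV. of_real (-2 * (J $ I \<bullet> T $ I)))"
    unfolding tdot_def vec_cnj_def by (simp add: sum_negf sum_subtractf[symmetric] flip: sum_negf)
  then show ?thesis
    by (simp add: inner_vec_def sum_distrib_left sum_negf)
qed

lemma tensor_gaussian_eq:
  "(tensor_gaussian :: ('d::finite, 'n::finite) tensor measure) =
    density lborel (\<lambda>T. ennreal (gauss_weight (real (CARD('n) ^ (CARD('d) - 1))) 0 T /
      (LINT S|lborel. gauss_weight (real (CARD('n) ^ (CARD('d) - 1))) 0 (S :: ('d, 'n) tensor))))"
  unfolding tensor_gaussian_def Let_def tdot_vec_cnj gauss_weight_def by simp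

lemma matrix_gaussian_eq:
  "(matrix_gaussian :: ('d::finite, 'n::finite) tmatrix measure) =
    density lborel (\<lambda>M. ennreal (gauss_weight 1 0 M / pi ^ (CARD('n) ^ (2 * CARD('d)))))"
proof -
  have "(\<Sum>I\<in>UNIV. \<Sum>K\<in>UNIV. M $ I $ K * mat_cnj M $ I $ K) = of_real ((norm M)\<^sup>2)" for M :: "('d, 'n) tmatrix"
    unfolding power2_norm_eq_inner inner_vec_def of_real_sum mat_cnj_def
    by (intro sum.cong refl) (simp add: complex_eq_iff inner_complex_def power2_eq_square)
  then show ?thesis unfolding matrix_gaussian_def gauss_weight_def by simp
qed

lemma gauss_integral_1_matrix:
  "gauss_integral 1 0 (\<lambda>_::('d::finite, 'n::finite) tmatrix. 1) = of_real (pi ^ (CARD('n) ^ (2 * CARD('d))))"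
proof -
  have "DIM(('d, 'n) tmatrix) = 2 * CARD('n) ^ (2 * CARD('d))"
    by (simp add: card_fun power_add mult_2)
  moreover have "sqrt (pi / 1) ^ (2 * k) = pi ^ k" for k
    by (simp add: power_mult)
  ultimately show ?thesis
    using gauss_integral_1[where 'a="('d, 'n) tmatrix", OF zero_less_one] by (simp only:)
qed

lemma has_sum_single: "((\<lambda>m. if m = a then x else 0) has_sum x) UNIV"
  for x :: "'a::{topological_space, comm_monoid_add}"
proof -
  have "((\<lambda>m. if m = a then x else 0) has_sum (\<Sum>m\<in>{a}. if m = a then x else 0)) {a}"
    by (rule has_sum_finite) simp
  then show ?thesis by (subst has_sum_cong_neutral[where T="{a}" and g="\<lambda>m. if m = a then x else 0"]) auto
qed

lemma intermediate_field_representation: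
  fixes B :: "('v, 'd::finite) coloured_graph" and J :: "('d, 'n::finite) tensor"
  assumes "bubble B" "card (vertices B) = 2 * n" "pairing B \<Omega>"
  shows "\<exists>Z. has_formal_integral tensor_gaussian (tensor_source_integrand B n s J) Z \<and>
    has_graded_formal_integral matrix_gaussian (matrix_source_integrand B \<Omega> n s J) Z"
proof -
  define c where "c = real (CARD('n) ^ (CARD('d) - 1))"
  have c: "c > 0" by (simp add: c_def)
  define Z0 where "Z0 = (LINT S|lborel. gauss_weight c 0 (S :: ('d, 'n) tensor))"
  have Z0': "gauss_integral c 0 (\<lambda>_::('d, 'n) tensor. 1) = of_real Z0"
    unfolding gauss_integral_def Z0_def by simp
  have "Z0 = sqrt (pi / c) ^ DIM(('d, 'n) tensor)"
    using gauss_integral_1[OF c, where 'a="('d, 'n) tensor"] unfolding Z0' of_real_eq_iff .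
  then have Z0: "Z0 > 0" using c by simp
  \<comment> \<open>\<open>\<alpha>\<close> and \<open>\<beta>\<close> are the factors in front of
    the bubble in the two exponents, tensor side and matrix side.\<close>
  define \<alpha> where "\<alpha> = - (complex_of_real (real CARD('n) powr s) / of_nat n)"
  define \<beta> where "\<beta> = - ((- 1) ^ n * complex_of_real (real CARD('n) powr (s - real n * (real CARD('d) - 1))) / of_nat n)"
  \<comment> \<open>Power counting: evaluating a bubble of degree \<open>n\<close> brings out
    \<open>(- c) ^ n\<close>, whose sign cancels against \<open>(- 1) ^ n\<close> and whose modulus
    turns the matrix scaling into that of the tensor model.\<close>
  have \<alpha>\<beta>: "\<beta> * (- of_real c) ^ n = \<alpha>"
  proof -
    \<comment> \<open>\<open>CARD('d)\<close> is positive, so the truncated subtraction in the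
      exponent agrees with the real one.\<close>
    have "c = real CARD('n) powr (real CARD('d) - 1)"
      using powr_realpow[of "real CARD('n)" "CARD('d) - 1"] by (simp add: c_def of_nat_diff Suc_leI)
    then have "c ^ n = real CARD('n) powr (real n * (real CARD('d) - 1))"
      by (simp add: powr_power mult.commute)
    then have "real CARD('n) powr (s - real n * (real CARD('d) - 1)) * c ^ n = real CARD('n) powr s"
      by (simp add: powr_add[symmetric])
    then have "complex_of_real (real CARD('n) powr (s - real n * (real CARD('d) - 1))) * of_real c ^ n = of_real (real CARD('n) powr s)"
      unfolding of_real_power[symmetric] of_real_mult[symmetric] by simp
    then have "\<beta> * (- of_real c) ^ n = - ((- 1) ^ n * (- 1) ^ n * of_real (real CARD('n) powr s) / of_nat n)"
      unfolding \<beta>_def power_minus[of "of_real c"] by (simp add: mult_ac)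
    then show ?thesis unfolding \<alpha>_def by (simp flip: power_mult_distrib)
  qed
  define Z where "Z = Abs_fps (\<lambda>k. gauss_integral c (-2 *\<^sub>R J) (\<lambda>T. tensor_integrand B n s T k) / of_real Z0)"
  have ti: "tensor_integrand B n s T k = \<alpha> ^ k / fact k * bubble_trace B T (vec_cnj T) ^ k" for T :: "('d, 'n) tensor" and k
    unfolding tensor_integrand_def \<alpha>_def by (simp flip: power_mult_distrib)
  have "has_formal_integral tensor_gaussian (tensor_source_integrand B n s J) Z"
    unfolding has_formal_integral_def
  proof
    fix k
    \<comment> \<open>The exponential of the sources moves into the weight, which leaves an
      integrand of polynomial growth.\<close>
    have w: "of_real (gauss_weight c 0 T) * tensor_source_integrand B n s J T k = of_real (gauss_weight c (-2 *\<^sub>R J) T) * tensor_integrand B n s T k" for T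
    proof -
      have "gauss_weight c (-2 *\<^sub>R J) T = gauss_weight c 0 T * exp ((-2 *\<^sub>R J) \<bullet> T)"
        unfolding gauss_weight_def by (simp flip: exp_add)
      then show ?thesis unfolding tensor_source_integrand_def source_exponent exp_of_real by simp
    qed
    have "integrable lborel (\<lambda>T. of_real (gauss_weight c (-2 *\<^sub>R J) T) * tensor_integrand B n s T k)"
      unfolding ti by (intro poly_growth_gauss_weight_integrable c poly_growth_intros poly_growth_bubble_trace)
    from has_bochner_integral_gauss_density[OF Z0, of c 0 "\<lambda>T. tensor_source_integrand B n s J T k", unfolded w, OF this]
    show "has_bochner_integral tensor_gaussian (\<lambda>T. tensor_source_integrand B n s J T k) (fps_nth Z k)"
      unfolding tensor_gaussian_eq c_def[symmetric] Z0_def[symmetric] Z_def gauss_integral_def w by simp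
  qed
  moreover have "has_graded_formal_integral matrix_gaussian (matrix_source_integrand B \<Omega> n s J) Z"
  proof -
    note w = card_whites[OF assms(1,3,2)]
    have hom: "homogeneous (n * k) (\<lambda>M :: ('d, 'n) tmatrix. (\<beta> ^ k / fact k / of_real Z0) * matrix_bubble B \<Omega> M ^ k)" for k
      using homogeneous_mult_const[OF homogeneous_power[OF homogeneous_matrix_bubble[OF w(1)]]] unfolding w(2) by blast
    have mi: "matrix_source_integrand B \<Omega> n s J M k m =
      ((\<beta> ^ k / fact k / of_real Z0) * matrix_bubble B \<Omega> M ^ k) * fps_nth (moment_series c J (mat_cnj M) (\<lambda>_. 1)) m" for M k m
    proof -
      have "matrix_source_integrand B \<Omega> n s J M k m = (\<beta> * matrix_bubble B \<Omega> M) ^ k / fact k *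
        fps_nth (formal_exp (- tr_ln_one_plus (mat_cnj M) + fps_const (1 / of_real c) * tr_resolvent (source_matrix J) (mat_cnj M))) m"
        unfolding matrix_source_integrand_def matrix_interaction_def \<beta>_def c_def by simp
      then show ?thesis
        unfolding moment_series_eq_formal_exp[OF c] Z0' using Z0 by (simp add: power_mult_distrib)
    qed
    \<comment> \<open>The power \<open>k\<close> of the matrix bubble is homogeneous of degree
      \<open>n * k\<close>, so the sum over \<open>m\<close> in the graded integral reduces to one
      term.\<close>
    have bi: "has_bochner_integral matrix_gaussian (\<lambda>M. matrix_source_integrand B \<Omega> n s J M k m)
       (if m = n * k then fps_nth Z k else 0)" for k m
    proof -
      note avg = intermediate_field_average[OF c hom[of k], where J=J and m=m]
      have "has_bochner_integral matrix_gaussian (\<lambda>M. matrix_source_integrand B \<Omega> n s J M k m)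
        (gauss_integral 1 0 (\<lambda>M. matrix_source_integrand B \<Omega> n s J M k m) / of_real (pi ^ (CARD('n) ^ (2 * CARD('d)))))"
        unfolding matrix_gaussian_eq mi by (intro has_bochner_integral_gauss_density avg(1)) simp
      also have "gauss_integral 1 0 (\<lambda>M. matrix_source_integrand B \<Omega> n s J M k m) / of_real (pi ^ (CARD('n) ^ (2 * CARD('d)))) =
        (if m = n * k then (- of_real c) ^ (n * k) * gauss_integral c (-2 *\<^sub>R J) (\<lambda>T. (\<beta> ^ k / fact k / of_real Z0) * bubble_trace B T (vec_cnj T) ^ k) else 0)"
        unfolding mi avg(2) gauss_integral_1_matrix matrix_bubble_rank_one[OF assms(3)] by simp
      also have "\<dots> = (if m = n * k then fps_nth Z k else 0)"
        unfolding Z_def ti \<alpha>\<beta>[symmetric] gauss_integral_mult_left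
        by (simp add: power_mult_distrib power_mult)
      finally show ?thesis .
    qed
    show ?thesis
      unfolding has_graded_formal_integral_def
      using bi by (auto simp: has_bochner_integral_iff has_sum_single)
  qed
  ultimately show ?thesis by blast
qed

theorem theorem2p6p1:
  fixes B :: "('v, 'd :: finite) coloured_graph"
    and \<Omega> :: "'v \<Rightarrow> 'v"
    and n :: nat
    and s :: real
  assumes "bubble B"
    and "card (vertices B) = 2 * n"
    and "pairing B \<Omega>"
  shows "(\<exists>Z.
      has_formal_integral (tensor_gaussian :: ('d, 'n :: finite) tensor measure)
        (tensor_integrand B n s) Z \<and>
      has_graded_formal_integral (matrix_gaussian :: ('d, 'n) tmatrix measure)
        (matrix_integrand B \<Omega> n s) Z) \<and>
    (\<forall>J :: ('d, 'n) tensor. \<exists>Z.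
      has_formal_integral tensor_gaussian (tensor_source_integrand B n s J) Z \<and>
      has_graded_formal_integral matrix_gaussian (matrix_source_integrand B \<Omega> n s J) Z)"
proof -
  have sources: "\<exists>Z. has_formal_integral tensor_gaussian (tensor_source_integrand B n s J) Z \<and>
    has_graded_formal_integral matrix_gaussian (matrix_source_integrand B \<Omega> n s J) Z"
    for J :: "('d, 'n) tensor"
    using assms by (rule intermediate_field_representation)
  \<comment> \<open>The representation without sources is the case \<open>J = 0\<close>, where the
    source exponential is \<open>1\<close> and the resolvent term vanishes.\<close>
  have tensor: "tensor_source_integrand B n s 0 = (tensor_integrand B n s :: ('d, 'n) tensor \<Rightarrow> nat \<Rightarrow> complex)"
    by (intro ext) (simp add: tensor_source_integrand_def tdot_def vec_cnj_def)
  have "source_matrix (0 :: ('d, 'n) tensor) = 0"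
    by (simp add: source_matrix_def vec_eq_iff)
  then have "tr_resolvent (source_matrix (0 :: ('d, 'n) tensor)) A = 0" for A
    by (intro fps_ext) (simp add: tr_resolvent_def trace_series_def trace_def matrix_matrix_mult_def)
  then have matrix: "matrix_source_integrand B \<Omega> n s (0 :: ('d, 'n) tensor) = matrix_integrand B \<Omega> n s"
    by (intro ext) (simp add: matrix_source_integrand_def matrix_integrand_def)
  show ?thesis
    using sources[of 0] sources unfolding tensor matrix by blast
qed

end
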